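(* Let $m\ge 3$ be an odd integer and let $n\ge 2$. Let $\rho_R:\mathcal B_n\to \mathrm{End}((\mathbb C^2)^{\otimes (n+1)})$ be the qubit representation of the braid group $\mathcal B_n$ determined by $\rho_R(\sigma_i)=I^{\otimes(i-1)}\otimes R\otimes I^{\otimes(n-i-1)}$ for $1\le i\le n-1$, where $R=R_m$ is the $8\times 8$ matrix given in the context. Then the image $\rho_R(\mathcal B_n)$ is isomorphic, as a group, to a semidirect product $\mathbb Z_m^{\frac{n(n-1)}{2}}\rtimes S_n$ (for some action of the symmetric group $S_n$ on $\mathbb Z_m^{\frac{n(n-1)}{2}}$ by automorphisms).
   Context: $\mathcal B_n$ is the braid group on $n$ strings with standard generators $\sigma_1,\dots,\sigma_{n-1}$ (relations $\sigma_i\sigma_{i+1}\sigma_i=\sigma_{i+1}\sigma_i\sigma_{i+1}$ and $\sigma_i\sigma_j=\sigma_j\sigma_i$ for $|i-j|\ge 2$). $\mathbb Z_m$ is the cyclic group of order $m$. $I$ is the identity on $\mathbb C^2$, which has basis $|0\rangle,|1\rangle$; for a bit $b$, $\bar b=1-b$. Let $m\ge 3$ be odd; put $\nu=-1$ if $m=3$ and $\nu=+1$ if $m\ge 5$. The invertible operator $R:(\mathbb C^2)^{\otimes 3}\to(\mathbb C^2)^{\otimes 3}$ is defined on the basis $|abc\rangle$, $a,b,c\in\{0,1\}$, by $$R|abc\rangle=\begin{cases}\nu\cos(\tfrac{\pi}{m})|abc\rangle+i\sin(\tfrac{\pi}{m})|a\bar b c\rangle & \text{if } a=c,\\ -i\sin(\tfrac{\pi}{m})|abc\rangle+\cos(\tfrac{\pi}{m})|a\bar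 b c\rangle & \text{if } a\ne c.\end{cases}$$ It satisfies $(R\otimes I)(I\otimes R)(R\otimes I)=(I\otimes R)(R\otimes I)(I\otimes R)$, and the operators $I^{\otimes(i-1)}\otimes R\otimes I^{\otimes(n-i-1)}$, $1\le i\le n-1$, also satisfy far commutativity, so $\rho_R$ is a well-defined representation of $\mathcal B_n$ on $(\mathbb C^2)^{\otimes(n+1)}$. *)

theory Defs
  imports
    "HOL-Algebra.Bij"
    "HOL-Algebra.Product_Groups"
    "HOL-Algebra.Sym_Groups"
    "Jordan_Normal_Form.Determinant"
begin

section \<open>Groups given by generators and relations\<close>

text \<open>A letter \<open>(x, True)\<close> stands for the generator \<open>x\<close>, and \<open>(x, False)\<close> for its formal inverse.\<close>

type_synonym 'g gword = "('g \<times> bool) list"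

definition gwords :: "'g set \<Rightarrow> 'g gword set" where
  "gwords X = lists (X \<times> UNIV)"

inductive pres_eq :: "'g set \<Rightarrow> ('g gword \<times> 'g gword) set \<Rightarrow> 'g gword \<Rightarrow> 'g gword \<Rightarrow> bool"
  for X :: "'g set" and E :: "('g gword \<times> 'g gword) set" where
  refl: "w \<in> gwords X \<Longrightarrow> pres_eq X E w w"
| sym: "pres_eq X E u v \<Longrightarrow> pres_eq X E v u"
| trans: "pres_eq X E u v \<Longrightarrow> pres_eq X E v w \<Longrightarrow> pres_eq X E u w"
| append: "pres_eq X E u u' \<Longrightarrow> pres_eq X E v v' \<Longrightarrow> pres_eq X E (u @ v) (u' @ v')"
| cancel: "x \<in> X \<Longrightarrow> pres_eq X E [(x, b), (x, \<not> b)] []"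
| relation: "(u, v) \<in> E \<Longrightarrow> u \<in> gwords X \<Longrightarrow> v \<in> gwords X \<Longrightarrow> pres_eq X E u v"

definition pres_class :: "'g set \<Rightarrow> ('g gword \<times> 'g gword) set \<Rightarrow> 'g gword \<Rightarrow> 'g gword set" where
  "pres_class X E w = {v. pres_eq X E w v}"

definition presented_group :: "'g set \<Rightarrow> ('g gword \<times> 'g gword) set \<Rightarrow> 'g gword set monoid" where
  "presented_group X E =
    \<lparr>carrier = pres_class X E ` gwords X,
     monoid.mult = (\<lambda>A B. {w. \<exists>u\<in>A. \<exists>v\<in>B. pres_eq X E (u @ v) w}),
     one = pres_class X E []\<rparr>"

fun gword_eval :: "('a, 'b) monoid_scheme \<Rightarrow> ('g \<Rightarrow> 'a) \<Rightarrow> 'g gword \<Rightarrow> 'a" where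
  "gword_eval G f [] = \<one>\<^bsub>G\<^esub>"
| "gword_eval G f ((x, b) # w) = (if b then f x else inv\<^bsub>G\<^esub> (f x)) \<otimes>\<^bsub>G\<^esub> gword_eval G f w"

text \<open>The homomorphism determined by the images \<open>f x\<close> of the generators; meaningful when
  \<open>f\<close> respects the relations, see \<open>pres_hom_pres_class\<close> and \<open>pres_hom_hom\<close> below.\<close>

definition pres_hom :: "('a, 'b) monoid_scheme \<Rightarrow> ('g \<Rightarrow> 'a) \<Rightarrow> 'g gword set \<Rightarrow> 'a" where
  "pres_hom G f A = the_elem (gword_eval G f ` A)"


section \<open>Powers of cyclic groups and semidirect products\<close>

definition cyclic_power :: "nat \<Rightarrow> nat \<Rightarrow> (nat \<Rightarrow> int) monoid" where
  "cyclic_power m k = product_group {..<k} (\<lambda>_. integer_mod_group m)"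

text \<open>A group when \<open>N\<close> and \<open>H\<close> are groups and \<open>\<phi> \<in> hom H (AutoGroup N)\<close>.\<close>

definition semidirect_product ::
  "('a, 'c) monoid_scheme \<Rightarrow> ('b, 'd) monoid_scheme \<Rightarrow> ('b \<Rightarrow> 'a \<Rightarrow> 'a) \<Rightarrow> ('a \<times> 'b) monoid" where
  "semidirect_product N H \<phi> =
    \<lparr>carrier = carrier N \<times> carrier H,
     monoid.mult = (\<lambda>(a, h) (b, k). (a \<otimes>\<^bsub>N\<^esub> \<phi> h b, h \<otimes>\<^bsub>H\<^esub> k)),
     one = (\<one>\<^bsub>N\<^esub>, \<one>\<^bsub>H\<^esub>)\<rparr>"


section \<open>Braid groups\<close>

definition braid_relations :: "nat \<Rightarrow> (nat gword \<times> nat gword) set" where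
  "braid_relations n =
    {([(i, True), (i + 1, True), (i, True)], [(i + 1, True), (i, True), (i + 1, True)]) | i.
       i \<in> {1..<n} \<and> i + 1 \<in> {1..<n}} \<union>
    {([(i, True), (j, True)], [(j, True), (i, True)]) | i j.
       i \<in> {1..<n} \<and> j \<in> {1..<n} \<and> \<bar>int i - int j\<bar> \<ge> 2}"

definition braid_group :: "nat \<Rightarrow> nat gword set monoid" where
  "braid_group n = presented_group {1..<n} (braid_relations n)"

definition braid_gen :: "nat \<Rightarrow> nat \<Rightarrow> nat gword set" where
  "braid_gen n i = pres_class {1..<n} (braid_relations n) [(i, True)]"


section \<open>The representation\<close>

text \<open>Operators on \<open>(\<complex>\<^sup>2)\<^sup>\<otimes>\<^sup>k\<close> are written as \<open>2 ^ k \<times> 2 ^ k\<close> matrices acting on column vectors. The basis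
  vector labelled by the bits \<open>a\<^sub>1 \<dots> a\<^sub>k\<close> has index \<open>a\<^sub>1 * 2 ^ (k - 1) + \<dots> + a\<^sub>k\<close>, so that the tensor
  product of operators is the Kronecker product.\<close>

definition kron :: "'a::semiring_1 mat \<Rightarrow> 'a mat \<Rightarrow> 'a mat" where
  "kron A B = mat (dim_row A * dim_row B) (dim_col A * dim_col B)
     (\<lambda>(r, x). A $$ (r div dim_row B, x div dim_col B) * B $$ (r mod dim_row B, x mod dim_col B))"

fun kron_power :: "'a::semiring_1 mat \<Rightarrow> nat \<Rightarrow> 'a mat" where
  "kron_power A 0 = 1\<^sub>m 1"
| "kron_power A (Suc k) = kron A (kron_power A k)"

text \<open>Column \<open>x = 4 * a + 2 * b + c\<close> holds the image of the basis vector labelled \<open>a b c\<close>.\<close>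

definition R_mat :: "nat \<Rightarrow> complex mat" where
  "R_mat m = mat 8 8 (\<lambda>(r, x).
     let a = x div 4; b = x div 2 mod 2; c = x mod 2;
         y = 4 * a + 2 * (1 - b) + c;
         \<nu> = (if m = 3 then -1 else 1);
         C = complex_of_real (cos (pi / real m));
         S = complex_of_real (sin (pi / real m))
     in if a = c
        then (if r = x then \<nu> * C else if r = y then \<i> * S else 0)
        else (if r = x then - \<i> * S else if r = y then C else 0))"

definition sigma_mat :: "nat \<Rightarrow> nat \<Rightarrow> nat \<Rightarrow> complex mat" where
  "sigma_mat m n i =
     kron (kron (kron_power (1\<^sub>m 2) (i - 1)) (R_mat m)) (kron_power (1\<^sub>m 2) (n - i - 1))"

definition GL_mat :: "nat \<Rightarrow> complex mat monoid" where
  "GL_mat d = units_of (ring_mat TYPE(complex) d ())"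

text \<open>The homomorphism that sends the \<open>i\<close>-th braid generator to \<open>sigma_mat m n i\<close>; see \<open>rho_hom\<close> and
  \<open>rho_braid_gen\<close> below.\<close>

definition rho :: "nat \<Rightarrow> nat \<Rightarrow> nat gword set \<Rightarrow> complex mat" where
  "rho m n = pres_hom (GL_mat (2 ^ (n + 1))) (sigma_mat m n)"


section \<open>Well-definedness\<close>

subsection \<open>Presented groups\<close>

lemma pres_eq_gwords: "pres_eq X E u v \<Longrightarrow> u \<in> gwords X \<and> v \<in> gwords X"
  by (induction rule: pres_eq.induct) (auto simp: gwords_def)

lemma pres_class_eq_iff:
  assumes "u \<in> gwords X"
  shows "pres_class X E u = pres_class X E v \<longleftrightarrow> pres_eq X E u v"
proof
  assume "pres_class X E u = pres_class X E v"
  moreover have "u \<in> pres_class X E u" using assms by (simp add: pres_class_def pres_eq.refl)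
  ultimately show "pres_eq X E u v" by (simp add: pres_class_def pres_eq.sym)
next
  assume "pres_eq X E u v"
  then show "pres_class X E u = pres_class X E v"
    unfolding pres_class_def by (intro Collect_cong) (meson pres_eq.sym pres_eq.trans)
qed

lemma pres_class_mult:
  assumes u: "u \<in> gwords X" and v: "v \<in> gwords X"
  shows "pres_class X E u \<otimes>\<^bsub>presented_group X E\<^esub> pres_class X E v = pres_class X E (u @ v)"
proof -
  have "(\<exists>u'. pres_eq X E u u' \<and> (\<exists>v'. pres_eq X E v v' \<and> pres_eq X E (u' @ v') w))
      \<longleftrightarrow> pres_eq X E (u @ v) w" for w
    using pres_eq.refl[OF u] pres_eq.refl[OF v] by (meson pres_eq.append pres_eq.trans)
  then show ?thesis by (simp add: presented_group_def pres_class_def)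
qed

definition gword_inv :: "'g gword \<Rightarrow> 'g gword" where
  "gword_inv w = rev (map (\<lambda>(x, b). (x, \<not> b)) w)"

lemma gword_inv_gwords: "w \<in> gwords X \<Longrightarrow> gword_inv w \<in> gwords X"
  by (auto simp: gwords_def gword_inv_def)

lemma pres_eq_gword_inv: "w \<in> gwords X \<Longrightarrow> pres_eq X E (gword_inv w @ w) []"
proof (induction w)
  case Nil
  then show ?case by (auto simp: gword_inv_def gwords_def intro: pres_eq.refl)
next
  case (Cons a w)
  obtain x b where a: "a = (x, b)" by (cases a)
  have x: "x \<in> X" and w: "w \<in> gwords X" using Cons.prems a by (auto simp: gwords_def)
  have "pres_eq X E [(x, \<not> b), (x, \<not> \<not> b)] []" using x by (rule pres_eq.cancel)
  then have "pres_eq X E ([(x, \<not> b), (x, b)] @ w) ([] @ w)"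
    by (intro pres_eq.append pres_eq.refl[OF w]) simp
  then have "pres_eq X E (gword_inv w @ [(x, \<not> b), (x, b)] @ w) (gword_inv w @ [] @ w)"
    using pres_eq.append[OF pres_eq.refl[OF gword_inv_gwords[OF w]]] by blast
  then show ?case using Cons.IH[OF w] by (auto simp: a gword_inv_def intro: pres_eq.trans)
qed

lemma group_presented_group: "group (presented_group X E)"
proof (rule groupI)
  let ?G = "presented_group X E"
  have car: "carrier ?G = pres_class X E ` gwords X" and one: "\<one>\<^bsub>?G\<^esub> = pres_class X E []"
    by (simp_all add: presented_group_def)
  have nil: "[] \<in> gwords X" by (simp add: gwords_def)
  have app: "u @ v \<in> gwords X" if "u \<in> gwords X" "v \<in> gwords X" for u v
    using that by (simp add: gwords_def)
  show "\<one>\<^bsub>?G\<^esub> \<in> carrier ?G" using nil by (simp add: car one)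
  show "A \<otimes>\<^bsub>?G\<^esub> B \<in> carrier ?G" if "A \<in> carrier ?G" "B \<in> carrier ?G" for A B
    using that app by (auto simp: car pres_class_mult)
  show "A \<otimes>\<^bsub>?G\<^esub> B \<otimes>\<^bsub>?G\<^esub> D = A \<otimes>\<^bsub>?G\<^esub> (B \<otimes>\<^bsub>?G\<^esub> D)"
    if "A \<in> carrier ?G" "B \<in> carrier ?G" "D \<in> carrier ?G" for A B D
    using that app by (auto simp: car pres_class_mult)
  show "\<one>\<^bsub>?G\<^esub> \<otimes>\<^bsub>?G\<^esub> A = A" if "A \<in> carrier ?G" for A
    using that nil by (auto simp: car one pres_class_mult)
  show "\<exists>B\<in>carrier ?G. B \<otimes>\<^bsub>?G\<^esub> A = \<one>\<^bsub>?G\<^esub>" if "A \<in> carrier ?G" for A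
  proof -
    from that obtain w where w: "w \<in> gwords X" and A: "A = pres_class X E w" by (auto simp: car)
    have "pres_class X E (gword_inv w) \<otimes>\<^bsub>?G\<^esub> A = \<one>\<^bsub>?G\<^esub>"
      using w gword_inv_gwords[OF w] pres_eq_gword_inv[OF w] app
      by (simp add: A one pres_class_mult pres_class_eq_iff)
    then show ?thesis using gword_inv_gwords[OF w] by (auto simp: car)
  qed
qed

context group
begin

lemma gword_eval_closed:
  "f \<in> X \<rightarrow> carrier G \<Longrightarrow> w \<in> gwords X \<Longrightarrow> gword_eval G f w \<in> carrier G"
  by (induction w) (auto simp: gwords_def Pi_iff)

lemma gword_eval_append:
  assumes "f \<in> X \<rightarrow> carrier G" "u \<in> gwords X" "v \<in> gwords X"
  shows "gword_eval G f (u @ v) = gword_eval G f u \<otimes> gword_eval G f v"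
  using assms(2)
proof (induction u)
  case Nil
  then show ?case using gword_eval_closed[OF assms(1,3)] by simp
next
  case (Cons a u)
  obtain x b where a: "a = (x, b)" by (cases a)
  have "f x \<in> carrier G" and u: "u \<in> gwords X"
    using Cons.prems assms(1) by (auto simp: a gwords_def)
  then show ?case
    using Cons.IH[OF u] gword_eval_closed[OF assms(1)] assms(3) by (simp add: a m_assoc)
qed

lemma gword_eval_pres_eq:
  assumes f: "f \<in> X \<rightarrow> carrier G"
    and E: "\<And>u v. (u, v) \<in> E \<Longrightarrow> gword_eval G f u = gword_eval G f v"
    and "pres_eq X E u v"
  shows "gword_eval G f u = gword_eval G f v"
  using assms(3)
proof (induction rule: pres_eq.induct)
  case (append u u' v v')
  then show ?case by (metis f gword_eval_append pres_eq_gwords)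
next
  case (cancel x b)
  then have "f x \<in> carrier G" using f by auto
  then show ?case by simp
next
  case (relation u v)
  then show ?case by (intro E)
qed simp_all

lemma pres_hom_pres_class:
  assumes f: "f \<in> X \<rightarrow> carrier G"
    and E: "\<And>u v. (u, v) \<in> E \<Longrightarrow> gword_eval G f u = gword_eval G f v"
    and w: "w \<in> gwords X"
  shows "pres_hom G f (pres_class X E w) = gword_eval G f w"
proof -
  have "gword_eval G f ` pres_class X E w = {gword_eval G f w}"
  proof (intro equalityI subsetI)
    fix a assume "a \<in> gword_eval G f ` pres_class X E w"
    then obtain v where "pres_eq X E w v" "a = gword_eval G f v" by (auto simp: pres_class_def)
    then show "a \<in> {gword_eval G f w}" using gword_eval_pres_eq[OF f, of E w v] E by simp
  next
    fix a assume "a \<in> {gword_eval G f w}"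
    then show "a \<in> gword_eval G f ` pres_class X E w"
      using pres_eq.refl[OF w, of E] by (auto simp: pres_class_def)
  qed
  then show ?thesis by (simp add: pres_hom_def)
qed

lemma pres_hom_hom:
  assumes f: "f \<in> X \<rightarrow> carrier G"
    and E: "\<And>u v. (u, v) \<in> E \<Longrightarrow> gword_eval G f u = gword_eval G f v"
  shows "pres_hom G f \<in> hom (presented_group X E) G"
proof (rule homI)
  have car: "carrier (presented_group X E) = pres_class X E ` gwords X"
    by (simp add: presented_group_def)
  have eval: "pres_hom G f (pres_class X E w) = gword_eval G f w" if "w \<in> gwords X" for w
    using pres_hom_pres_class[OF f _ that] E by blast
  show "pres_hom G f A \<in> carrier G" if "A \<in> carrier (presented_group X E)" for A
    using that gword_eval_closed[OF f] by (auto simp: car eval)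
  show "pres_hom G f (A \<otimes>\<^bsub>presented_group X E\<^esub> B) = pres_hom G f A \<otimes> pres_hom G f B"
    if "A \<in> carrier (presented_group X E)" "B \<in> carrier (presented_group X E)" for A B
  proof -
    from that obtain u v where "u \<in> gwords X" "A = pres_class X E u"
      "v \<in> gwords X" "B = pres_class X E v" by (auto simp: car)
    moreover from this have "u @ v \<in> gwords X" by (simp add: gwords_def)
    ultimately show ?thesis
      by (simp add: pres_class_mult eval gword_eval_append[OF f])
  qed
qed

end

lemma group_braid_group: "group (braid_group n)"
  unfolding braid_group_def by (rule group_presented_group)

subsection \<open>Semidirect products\<close>

lemma group_semidirect_product:
  assumes "group N" and "group H" and "\<phi> \<in> hom H (AutoGroup N)"
  shows "group (semidirect_product N H \<phi>)"
proof -
  interpret N: group N by fact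
  interpret H: group H by fact
  interpret A: group "AutoGroup N" by (rule N.AutoGroup)
  interpret h: group_hom H "AutoGroup N" \<phi> by unfold_locales (rule assms(3))
  have car: "carrier (AutoGroup N) = auto N" and one: "\<one>\<^bsub>AutoGroup N\<^esub> = (\<lambda>x\<in>carrier N. x)"
    by (simp_all add: AutoGroup_def BijGroup_def)
  have aut: "\<phi> h \<in> auto N" if "h \<in> carrier H" for h using h.hom_closed[OF that] by (simp add: car)
  have closed: "\<phi> h a \<in> carrier N" if "h \<in> carrier H" "a \<in> carrier N" for h a
    using aut[OF that(1)] that(2) by (auto simp: auto_def hom_def)
  have add: "\<phi> h (a \<otimes>\<^bsub>N\<^esub> b) = \<phi> h a \<otimes>\<^bsub>N\<^esub> \<phi> h b"
    if "h \<in> carrier H" "a \<in> carrier N" "b \<in> carrier N" for h a b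
    using aut[OF that(1)] that(2,3) by (auto simp: auto_def hom_def)
  have comp: "\<phi> (h \<otimes>\<^bsub>H\<^esub> k) a = \<phi> h (\<phi> k a)"
    if "h \<in> carrier H" "k \<in> carrier H" "a \<in> carrier N" for h k a
    using h.hom_mult[OF that(1,2)] aut[OF that(1)] aut[OF that(2)] that(3)
    by (simp add: AutoGroup_def BijGroup_def auto_def compose_def)
  have id: "\<phi> \<one>\<^bsub>H\<^esub> a = a" if "a \<in> carrier N" for a
    using h.hom_one that by (simp add: one)
  show ?thesis
  proof (rule groupI, goal_cases)
    case (5 x)
    then obtain a h where x: "x = (a, h)" "a \<in> carrier N" "h \<in> carrier H"
      by (auto simp: semidirect_product_def)
    define g where "g = inv\<^bsub>H\<^esub> h"
    have g: "g \<in> carrier H" "g \<otimes>\<^bsub>H\<^esub> h = \<one>\<^bsub>H\<^esub>" using x by (simp_all add: g_def)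
    have "\<phi> g \<one>\<^bsub>N\<^esub> = \<one>\<^bsub>N\<^esub>"
      using add[OF g(1), of "\<one>\<^bsub>N\<^esub>" "\<one>\<^bsub>N\<^esub>"] closed[OF g(1), of "\<one>\<^bsub>N\<^esub>"] by simp
    then have "\<phi> g (inv\<^bsub>N\<^esub> a) \<otimes>\<^bsub>N\<^esub> \<phi> g a = \<one>\<^bsub>N\<^esub>"
      using add[OF g(1), of "inv\<^bsub>N\<^esub> a" a] x by simp
    then show ?case
      using x g closed by (intro bexI[of _ "(\<phi> g (inv\<^bsub>N\<^esub> a), g)"]) (auto simp: semidirect_product_def)
  qed (auto simp: semidirect_product_def closed add comp id N.m_assoc H.m_assoc
      simp del: h.hom_mult h.hom_one)
qed


subsection \<open>The braid relations for the matrices\<close>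

lemma kron_one: "kron (1\<^sub>m a) (1\<^sub>m b) = 1\<^sub>m (a * b)"
proof (rule eq_matI)
  fix r x assume r: "r < dim_row (1\<^sub>m (a * b))" and x: "x < dim_col (1\<^sub>m (a * b))"
  have b: "b > 0" using r by (cases b) auto
  have "r = x \<longleftrightarrow> r div b = x div b \<and> r mod b = x mod b" by (metis div_mult_mod_eq)
  moreover have "r div b < a" "x div b < a"
    using r x by (simp_all add: less_mult_imp_div_less)
  ultimately show "kron (1\<^sub>m a) (1\<^sub>m b) $$ (r, x) = (1\<^sub>m (a * b) :: 'a mat) $$ (r, x)"
    using r x b by (auto simp: kron_def)
qed (auto simp: kron_def)

lemma kron_power_one: "kron_power (1\<^sub>m d) k = 1\<^sub>m (d ^ k)"
  by (induction k) (auto simp: kron_one)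

lemma R_mat_entry:
  assumes "r < 8" "x < 8"
  shows "R_mat m $$ (r, x) =
    (if bit x 2 = bit x 0
     then (if r = x then (if m = 3 then -1 else 1) * complex_of_real (cos (pi / real m))
           else if r = flip_bit 1 x then \<i> * complex_of_real (sin (pi / real m)) else 0)
     else (if r = x then - \<i> * complex_of_real (sin (pi / real m))
           else if r = flip_bit 1 x then complex_of_real (cos (pi / real m)) else 0))"
proof -
  have x: "x \<in> {0, 1, 2, 3, 4, 5, 6, 7}" using assms(2) by auto
  have "x div 4 = x mod 2 \<longleftrightarrow> bit x 2 = bit x 0"
    using x by (auto simp: bit_iff_odd)
  moreover have "4 * (x div 4) + 2 * (1 - x div 2 mod 2) + x mod 2 = flip_bit 1 x"
    using x by (auto simp: flip_bit_eq_xor)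
  ultimately show ?thesis using assms by (simp add: R_mat_def Let_def)
qed

lemma nat_parts_eq_iff:
  fixes r x p :: nat
  shows "r = x \<longleftrightarrow> r div 2 ^ p div 8 = x div 2 ^ p div 8 \<and> r div 2 ^ p mod 8 = x div 2 ^ p mod 8
    \<and> r mod 2 ^ p = x mod 2 ^ p"
  by (metis div_mult_mod_eq)

lemma flip_bit_parts:
  fixes x p :: nat
  shows "flip_bit (Suc p) x div 2 ^ p div 8 = x div 2 ^ p div 8"
    and "flip_bit (Suc p) x div 2 ^ p mod 8 = flip_bit 1 (x div 2 ^ p mod 8)"
    and "flip_bit (Suc p) x mod 2 ^ p = x mod 2 ^ p"
proof -
  have 8: "(8::nat) = 2 ^ 3" by simp
  show "flip_bit (Suc p) x div 2 ^ p div 8 = x div 2 ^ p div 8"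
    unfolding 8 drop_bit_eq_div[symmetric]
    by (rule bit_eqI) (auto simp: bit_drop_bit_eq bit_flip_bit_iff)
  show "flip_bit (Suc p) x div 2 ^ p mod 8 = flip_bit 1 (x div 2 ^ p mod 8)"
    unfolding 8 drop_bit_eq_div[symmetric] take_bit_eq_mod[symmetric]
    by (rule bit_eqI) (auto simp: bit_drop_bit_eq bit_take_bit_iff bit_flip_bit_iff)
  show "flip_bit (Suc p) x mod 2 ^ p = x mod 2 ^ p"
    unfolding 8 take_bit_eq_mod[symmetric]
    by (rule bit_eqI) (auto simp: bit_take_bit_iff bit_flip_bit_iff)
qed

lemma flip_bit_less:
  fixes x k d :: nat
  assumes "x < 2 ^ d" "k < d"
  shows "flip_bit k x < 2 ^ d"
proof -
  have "take_bit d (flip_bit k x) = flip_bit k (take_bit d x)"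
    using assms(2) by (intro bit_eqI) (auto simp: bit_take_bit_iff bit_flip_bit_iff)
  also have "take_bit d x = x" using assms(1) by (rule take_bit_nat_eq_self)
  finally show ?thesis by (metis take_bit_nat_less_exp)
qed

lemma kron_dim [simp]:
  "dim_row (kron A B) = dim_row A * dim_row B" "dim_col (kron A B) = dim_col A * dim_col B"
  by (simp_all add: kron_def)

lemma R_mat_dim [simp]: "dim_row (R_mat m) = 8" "dim_col (R_mat m) = 8"
  by (simp_all add: R_mat_def)

lemma sigma_mat_dim:
  assumes "i \<in> {1..<n}"
  shows "(2::nat) ^ (i - 1) * 8 * 2 ^ (n - i - 1) = 2 ^ (n + 1)"
proof -
  have "i - 1 + 3 + (n - i - 1) = n + 1" using assms by auto
  then have "(2::nat) ^ (i - 1) * 2 ^ 3 * 2 ^ (n - i - 1) = 2 ^ (n + 1)" by (metis power_add)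
  then show ?thesis by simp
qed

lemma sigma_mat_carrier:
  assumes "i \<in> {1..<n}"
  shows "sigma_mat m n i \<in> carrier_mat (2 ^ (n + 1)) (2 ^ (n + 1))"
  unfolding sigma_mat_dim[OF assms, symmetric]
  by (rule carrier_matI) (simp_all add: sigma_mat_def kron_power_one)

definition sigma_diag :: "nat \<Rightarrow> nat \<Rightarrow> nat \<Rightarrow> complex" where
  "sigma_diag m p x = (if bit x (p + 2) = bit x p
     then (if m = 3 then -1 else 1) * complex_of_real (cos (pi / real m))
     else - \<i> * complex_of_real (sin (pi / real m)))"

definition sigma_flip :: "nat \<Rightarrow> nat \<Rightarrow> nat \<Rightarrow> complex" where
  "sigma_flip m p x = (if bit x (p + 2) = bit x p
     then \<i> * complex_of_real (sin (pi / real m))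
     else complex_of_real (cos (pi / real m)))"

definition sigma_op :: "nat \<Rightarrow> nat \<Rightarrow> (nat \<Rightarrow> complex) \<Rightarrow> nat \<Rightarrow> complex" where
  "sigma_op m p v x = sigma_diag m p x * v x + sigma_flip m p x * v (flip_bit (Suc p) x)"

lemma flip_bit_neq: "flip_bit k x \<noteq> (x :: nat)"
proof
  assume "flip_bit k x = x"
  then have "bit (flip_bit k x) k = bit x k" by simp
  then show False by (simp add: bit_flip_bit_iff)
qed

lemma flip_bit_flip_bit: "flip_bit k (flip_bit k x) = (x :: nat)"
  by (rule bit_eqI) (auto simp: bit_flip_bit_iff)

lemma sigma_mat_entry:
  assumes i: "i \<in> {1..<n}" and r: "r < 2 ^ (n + 1)" and x: "x < 2 ^ (n + 1)"
  shows "sigma_mat m n i $$ (r, x) =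
    (if r = x then sigma_diag m (n - i - 1) x
     else if r = flip_bit (Suc (n - i - 1)) x then sigma_flip m (n - i - 1) x else 0)"
proof -
  define p where "p = n - i - 1"
  define r' where "r' = r div 2 ^ p mod 8"
  define x' where "x' = x div 2 ^ p mod 8"
  have dim: "(2::nat) ^ (i - 1) * 8 * 2 ^ p = 2 ^ (n + 1)"
    unfolding p_def using i by (rule sigma_mat_dim)
  have hi: "y div 2 ^ p < 2 ^ (i - 1) * 8" if "y < 2 ^ (n + 1)" for y :: nat
    using that unfolding dim[symmetric] by (rule less_mult_imp_div_less)
  have hi': "y div 2 ^ p div 8 < 2 ^ (i - 1)" if "y < 2 ^ (n + 1)" for y :: nat
    using hi[OF that] by (rule less_mult_imp_div_less)
  have lt: "r' < 8" "x' < 8" by (simp_all add: r'_def x'_def)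
  have "x' = take_bit 3 (drop_bit p x)" by (simp add: x'_def take_bit_eq_mod drop_bit_eq_div)
  then have bits: "bit x' 0 = bit x p" "bit x' 2 = bit x (p + 2)"
    by (simp_all add: bit_take_bit_iff bit_drop_bit_eq add.commute)
  have eq1: "r = x \<longleftrightarrow> r div 2 ^ p div 8 = x div 2 ^ p div 8 \<and> r' = x' \<and> r mod 2 ^ p = x mod 2 ^ p"
    unfolding r'_def x'_def by (rule nat_parts_eq_iff)
  have eq2: "r = flip_bit (Suc p) x \<longleftrightarrow> r div 2 ^ p div 8 = x div 2 ^ p div 8 \<and> r' = flip_bit 1 x'
      \<and> r mod 2 ^ p = x mod 2 ^ p"
    unfolding r'_def x'_def using nat_parts_eq_iff[of r "flip_bit (Suc p) x" p]
    by (simp only: flip_bit_parts)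
  have "sigma_mat m n i = kron (kron (1\<^sub>m (2 ^ (i - 1))) (R_mat m)) (1\<^sub>m (2 ^ p))"
    by (simp add: sigma_mat_def kron_power_one p_def)
  then have "sigma_mat m n i $$ (r, x) =
      (if r div 2 ^ p div 8 = x div 2 ^ p div 8 then 1 else 0) * R_mat m $$ (r', x')
        * (if r mod 2 ^ p = x mod 2 ^ p then 1 else 0)"
    using r[folded dim] x[folded dim] hi[OF r] hi[OF x] hi'[OF r] hi'[OF x]
    by (simp add: kron_def r'_def x'_def del: One_nat_def)
  then show ?thesis
    unfolding p_def[symmetric] eq1 eq2 R_mat_entry[OF lt] sigma_diag_def sigma_flip_def bits
    using flip_bit_neq[of 1 x'] by auto
qed

lemma sigma_mat_mult_entry:
  assumes i: "i \<in> {1..<n}" and A: "A \<in> carrier_mat (2 ^ (n + 1)) k"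
    and x: "x < 2 ^ (n + 1)" and c: "c < k"
  shows "(sigma_mat m n i * A) $$ (x, c) = sigma_op m (n - i - 1) (\<lambda>y. A $$ (y, c)) x"
proof -
  let ?p = "n - i - 1" let ?y = "flip_bit (Suc ?p) x" let ?M = "sigma_mat m n i"
  have p: "Suc ?p < n + 1" using i by auto
  have y: "?y < 2 ^ (n + 1)" using x p by (rule flip_bit_less)
  have "(?M * A) $$ (x, c) = (\<Sum>j\<in>{0..<2 ^ (n + 1)}. ?M $$ (x, j) * A $$ (j, c))"
    using sigma_mat_carrier[OF i, of m] A x c by (auto simp: scalar_prod_def)
  also have "\<dots> = (\<Sum>j\<in>{x, ?y}. ?M $$ (x, j) * A $$ (j, c))"
    using x y by (intro sum.mono_neutral_right)
      (auto simp: sigma_mat_entry[OF i x] flip_bit_flip_bit)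
  also have "\<dots> = sigma_op m ?p (\<lambda>y. A $$ (y, c)) x"
    using flip_bit_neq[of "Suc ?p" x] x y
    by (auto simp: sigma_mat_entry[OF i x] flip_bit_flip_bit sigma_op_def sigma_diag_def
        sigma_flip_def bit_flip_bit_iff)
  finally show ?thesis .
qed

lemma cos_sin_complex:
  "complex_of_real (sin t) * complex_of_real (sin t) = 1 - complex_of_real (cos t) * complex_of_real (cos t)"
  by (metis add_diff_cancel_left' of_real_1 of_real_add of_real_mult power2_eq_square sin_cos_squared_add2)

lemma sigma_op_far:
  assumes "p + 2 \<le> q"
  shows "sigma_op m p (sigma_op m q v) x = sigma_op m q (sigma_op m p v) x"
proof -
  have "flip_bit (Suc q) (flip_bit (Suc p) x) = flip_bit (Suc p) (flip_bit (Suc q) x)"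
    by (rule bit_eqI) (auto simp: bit_flip_bit_iff)
  then show ?thesis
    using assms by (simp add: sigma_op_def sigma_diag_def sigma_flip_def bit_flip_bit_iff algebra_simps)
qed

lemma sigma_op_braid:
  "sigma_op m p (sigma_op m (Suc p) (sigma_op m p v)) x
    = sigma_op m (Suc p) (sigma_op m p (sigma_op m (Suc p) v)) x"
proof -
  define C where "C = complex_of_real (cos (pi / real m))"
  define S where "S = complex_of_real (sin (pi / real m))"
  have C3: "m = 3 \<Longrightarrow> C = 1 / 2" by (simp add: C_def cos_60)
  have flip: "flip_bit (Suc (Suc p)) (flip_bit (Suc p) y) = flip_bit (Suc p) (flip_bit (Suc (Suc p)) y)" for y
    by (rule bit_eqI) (auto simp: bit_flip_bit_iff)
  show ?thesis
    by (cases "bit x p"; cases "bit x (Suc p)"; cases "bit x (Suc (Suc p))";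
        cases "bit x (Suc (Suc (Suc p)))"; cases "m = 3")
      (simp_all add: sigma_op_def sigma_diag_def sigma_flip_def bit_flip_bit_iff flip_bit_flip_bit
        flip C3 algebra_simps flip: C_def S_def)
qed

lemma sigma_mat_Units:
  assumes i: "i \<in> {1..<n}"
  shows "sigma_mat m n i \<in> Units (ring_mat TYPE(complex) (2 ^ (n + 1)) ())"
proof -
  let ?N = "2 ^ (n + 1) :: nat" and ?p = "n - i - 1" and ?M = "sigma_mat m n i"
  define B where "B = mat ?N ?N (\<lambda>(x, y). if x = y then cnj (sigma_diag m ?p x)
    else if x = flip_bit (Suc ?p) y then cnj (sigma_flip m ?p x) else 0)"
  have M: "?M \<in> carrier_mat ?N ?N" using i by (rule sigma_mat_carrier)
  have B: "B \<in> carrier_mat ?N ?N" by (simp add: B_def)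
  have p: "Suc ?p < n + 1" using i by auto
  have "?M * B = 1\<^sub>m ?N"
  proof (rule eq_matI)
    fix x c assume "x < dim_row (1\<^sub>m ?N :: complex mat)" "c < dim_col (1\<^sub>m ?N :: complex mat)"
    then have x: "x < ?N" and c: "c < ?N" by simp_all
    have y: "flip_bit (Suc ?p) x < ?N" using x p by (rule flip_bit_less)
    have inj: "flip_bit (Suc ?p) x = flip_bit (Suc ?p) c \<longleftrightarrow> x = c"
      by (metis flip_bit_flip_bit)
    have swap: "flip_bit (Suc ?p) x = c \<longleftrightarrow> x = flip_bit (Suc ?p) c"
      by (metis flip_bit_flip_bit)
    have "sigma_op m ?p (\<lambda>y. B $$ (y, c)) x = (if x = c then 1 else 0)"
      using x c y inj swap flip_bit_neq[of "Suc ?p" c] flip_bit_neq[of "Suc ?p" x]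
      by (auto simp: sigma_op_def B_def sigma_diag_def sigma_flip_def bit_flip_bit_iff
          cos_sin_complex algebra_simps split del: if_split split: if_splits)
    then show "(?M * B) $$ (x, c) = 1\<^sub>m ?N $$ (x, c)"
      using sigma_mat_mult_entry[OF i B x c] x c by simp
  qed (use M B in auto)
  moreover from this have "B * ?M = 1\<^sub>m ?N"
    using mat_mult_left_right_inverse[OF M B] by simp
  ultimately show ?thesis
    using M B by (auto simp: Units_def ring_mat_simps)
qed

lemma group_GL_mat: "group (GL_mat d)"
  unfolding GL_mat_def by (rule monoid.units_group[OF ring.is_monoid[OF ring_mat]])

lemma GL_mat_simps [simp]: "monoid.mult (GL_mat d) = (*)" "one (GL_mat d) = 1\<^sub>m d"
  by (simp_all add: GL_mat_def units_of_def ring_mat_simps)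

lemma sigma_mat_GL: "i \<in> {1..<n} \<Longrightarrow> sigma_mat m n i \<in> carrier (GL_mat (2 ^ (n + 1)))"
  using sigma_mat_Units by (simp add: GL_mat_def units_of_carrier)

lemma sigma_op_cong:
  assumes "i \<in> {1..<n}" "x < 2 ^ (n + 1)" "\<And>y. y < 2 ^ (n + 1) \<Longrightarrow> v y = w y"
  shows "sigma_op m (n - i - 1) v x = sigma_op m (n - i - 1) w x"
proof -
  have "flip_bit (Suc (n - i - 1)) x < 2 ^ (n + 1)" using assms(1,2) by (intro flip_bit_less) auto
  then show ?thesis using assms(2,3) by (simp add: sigma_op_def)
qed

text \<open>It is convenient to compare products of the matrices through their action on columns.\<close>

definition sigma_word_op :: "nat \<Rightarrow> nat \<Rightarrow> nat list \<Rightarrow> (nat \<Rightarrow> complex) \<Rightarrow> nat \<Rightarrow> complex" where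
  "sigma_word_op m n w = foldr (\<lambda>i. sigma_op m (n - i - 1)) w"

definition sigma_word_mat :: "nat \<Rightarrow> nat \<Rightarrow> nat list \<Rightarrow> complex mat" where
  "sigma_word_mat m n w = foldr (\<lambda>i A. sigma_mat m n i * A) w (1\<^sub>m (2 ^ (n + 1)))"

lemma sigma_word_mat_carrier:
  "set w \<subseteq> {1..<n} \<Longrightarrow> sigma_word_mat m n w \<in> carrier_mat (2 ^ (n + 1)) (2 ^ (n + 1))"
  by (induction w) (auto simp: sigma_word_mat_def intro!: mult_carrier_mat sigma_mat_carrier[simplified])

lemma sigma_word_mat_entry:
  assumes "set w \<subseteq> {1..<n}" "x < 2 ^ (n + 1)" "c < 2 ^ (n + 1)"
  shows "sigma_word_mat m n w $$ (x, c) = sigma_word_op m n w (\<lambda>y. 1\<^sub>m (2 ^ (n + 1)) $$ (y, c)) x"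
  using assms(1,2)
proof (induction w arbitrary: x)
  case Nil
  then show ?case by (simp add: sigma_word_mat_def sigma_word_op_def)
next
  case (Cons i w)
  have i: "i \<in> {1..<n}" and w: "set w \<subseteq> {1..<n}" using Cons.prems by auto
  have "sigma_word_mat m n (i # w) $$ (x, c)
      = sigma_op m (n - i - 1) (\<lambda>y. sigma_word_mat m n w $$ (y, c)) x"
    using sigma_mat_mult_entry[OF i sigma_word_mat_carrier[OF w] Cons.prems(2) assms(3)]
    by (simp add: sigma_word_mat_def)
  also have "\<dots> = sigma_op m (n - i - 1)
      (sigma_word_op m n w (\<lambda>y. 1\<^sub>m (2 ^ (n + 1)) $$ (y, c))) x"
    using i Cons.prems(2) Cons.IH[OF w] by (rule sigma_op_cong)
  finally show ?case by (simp add: sigma_word_op_def)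
qed

lemma sigma_word_mat_eqI:
  assumes "set u \<subseteq> {1..<n}" "set w \<subseteq> {1..<n}" "sigma_word_op m n u = sigma_word_op m n w"
  shows "sigma_word_mat m n u = sigma_word_mat m n w"
  using assms sigma_word_mat_carrier[OF assms(1), of m] sigma_word_mat_carrier[OF assms(2), of m]
  by (intro eq_matI) (simp_all add: sigma_word_mat_entry del: power_Suc)

lemma sigma_word_mat_relations:
  assumes "(u, w) \<in> braid_relations n"
  shows "sigma_word_mat m n (map fst u) = sigma_word_mat m n (map fst w)"
  using assms unfolding braid_relations_def
proof (elim UnE CollectE exE conjE)
  fix i assume uw: "(u, w) = ([(i, True), (i + 1, True), (i, True)], [(i + 1, True), (i, True), (i + 1, True)])"
    and i: "i \<in> {1..<n}" "i + 1 \<in> {1..<n}"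
  have p: "n - i - 1 = Suc (n - (i + 1) - 1)" using i by auto
  have "sigma_word_op m n [i, i + 1, i] = sigma_word_op m n [i + 1, i, i + 1]"
    using sigma_op_braid[of m "n - (i + 1) - 1"] unfolding p[symmetric]
    by (simp add: sigma_word_op_def fun_eq_iff)
  then have "sigma_word_mat m n [i, i + 1, i] = sigma_word_mat m n [i + 1, i, i + 1]"
    using i by (intro sigma_word_mat_eqI) auto
  then show ?thesis using uw by simp
next
  fix i j assume uw: "(u, w) = ([(i, True), (j, True)], [(j, True), (i, True)])"
    and ij: "i \<in> {1..<n}" "j \<in> {1..<n}" "2 \<le> \<bar>int i - int j\<bar>"
  have "sigma_word_op m n [i, j] = sigma_word_op m n [j, i]"
  proof (cases "i < j")
    case True
    then have "n - j - 1 + 2 \<le> n - i - 1" using ij by auto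
    from sigma_op_far[OF this, of m] show ?thesis by (simp add: sigma_word_op_def fun_eq_iff)
  next
    case False
    then have "n - i - 1 + 2 \<le> n - j - 1" using ij by auto
    from sigma_op_far[OF this, of m] show ?thesis by (simp add: sigma_word_op_def fun_eq_iff)
  qed
  then have "sigma_word_mat m n [i, j] = sigma_word_mat m n [j, i]"
    using ij by (intro sigma_word_mat_eqI) auto
  then show ?thesis using uw by simp
qed

lemma gword_eval_sigma_word_mat:
  "\<forall>(i, b) \<in> set w. b \<Longrightarrow>
    gword_eval (GL_mat (2 ^ (n + 1))) (sigma_mat m n) w = sigma_word_mat m n (map fst w)"
  by (induction w) (auto simp: sigma_word_mat_def)

lemma gword_eval_braid_relations:
  assumes "(u, w) \<in> braid_relations n"
  shows "gword_eval (GL_mat (2 ^ (n + 1))) (sigma_mat m n) u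
    = gword_eval (GL_mat (2 ^ (n + 1))) (sigma_mat m n) w"
proof -
  have "\<forall>(i, b) \<in> set u. b" "\<forall>(i, b) \<in> set w. b"
    using assms by (auto simp: braid_relations_def)
  then show ?thesis by (metis gword_eval_sigma_word_mat sigma_word_mat_relations[OF assms])
qed

theorem rho_hom: "rho m n \<in> hom (braid_group n) (GL_mat (2 ^ (n + 1)))"
  unfolding rho_def braid_group_def
  using sigma_mat_GL gword_eval_braid_relations by (intro group.pres_hom_hom group_GL_mat) auto

theorem rho_braid_gen:
  assumes i: "i \<in> {1..<n}"
  shows "rho m n (braid_gen n i) = sigma_mat m n i"
proof -
  interpret group "GL_mat (2 ^ (n + 1))" by (rule group_GL_mat)
  have f: "sigma_mat m n \<in> {1..<n} \<rightarrow> carrier (GL_mat (2 ^ (n + 1)))" using sigma_mat_GL by auto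
  have "rho m n (braid_gen n i) = gword_eval (GL_mat (2 ^ (n + 1))) (sigma_mat m n) [(i, True)]"
    unfolding rho_def braid_gen_def
    using i by (intro pres_hom_pres_class[OF f] gword_eval_braid_relations) (simp_all add: gwords_def)
  then show ?thesis using sigma_mat_carrier[OF i, of m] by simp
qed

end

theory Submission
  imports Defs
begin

text \<open>
  The idea is a change of basis after which the braid generators become monomial matrices with
  transparent coefficients. A generator flips the middle one of three adjacent qubits, with
  coefficients that depend only on whether the outer two agree. Describe a bit string by its lowest
  bit and by its jumps, the sums modulo \<open>2\<close> of neighbouring bits. Flipping an inner bit flips the two
  jumps next to it, and the outer bits agree iff these two jumps are equal. So a generator acts on two
  adjacent jump qubits only. In terms of Pauli matrices it is the operator that swaps the two qubits
  times \<open>exp (- \<i> (\<pi> / m) Y \<otimes> Y)\<close> if \<open>m \<ge> 5\<close>, and it has a similar form with \<open>X\<close> in place of \<open>Y\<close> if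
  \<open>m = 3\<close>.

  Such an operator is monomial in the product basis of eigenvectors of \<open>Y\<close> (or of \<open>X\<close>, with
  alternating signs). Label this basis by the set \<open>T\<close> of positions with eigenvalue \<open>- 1\<close> and write
  \<open>y\<^sub>j = \<plusminus> 1\<close> for the eigenvalue at \<open>j\<close>. With \<open>\<zeta> = exp (2 \<pi> \<i> / m)\<close>, the generator that acts at \<open>j\<close> and
  \<open>j + 1\<close> sends \<open>f\<^sub>T\<close> to \<open>\<epsilon> \<zeta>\<^sup>e f\<^bsub>s T\<^esub>\<close>, where \<open>e = c y\<^sub>j y\<^bsub>j + 1\<^esub>\<close>, \<open>s\<close> is an adjacent transposition,
  \<open>\<epsilon>\<close> is a global sign and \<open>c\<close> is invertible modulo \<open>m\<close>; see \<open>sigma_op_eigenbasis\<close>.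

  Products of such matrices send \<open>f\<^sub>T\<close> to \<open>\<epsilon>(\<pi>) \<zeta>\<^bsup>q(\<pi> T)\<^esup> f\<^bsub>\<pi> T\<^esub>\<close>, where \<open>\<epsilon>\<close> is the sign character or
  trivial and \<open>q\<close> is a quadratic form \<open>\<Sum> a\<^bsub>jk\<^esub> y\<^sub>j y\<^sub>k\<close> over the pairs of positions, with
  coefficients modulo \<open>m\<close>. The coefficient families \<open>a\<close> form \<open>\<int>\<^sub>m\<close> to the power \<open>n (n - 1) / 2\<close>, and
  \<open>(a, \<pi>)\<close> multiply as in the semidirect product in which \<open>S\<^sub>n\<close> permutes the pairs
  (\<open>semidirect_matrix_hom\<close>). Two facts finish the proof, and both use that \<open>m\<close> is odd.

  \<^item> The matrix determines \<open>(a, \<pi>)\<close>: if it is the identity, then \<open>\<pi>\<close> fixes all sets \<open>T\<close>, and Fourier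
    inversion over the sets \<open>T\<close> recovers each \<open>a\<^bsub>jk\<^esub>\<close> up to a power of \<open>2\<close>, which is invertible modulo
    \<open>m\<close> (\<open>semidirect_matrix_eq_oneD\<close>).
  \<^item> The pairs \<open>(c e\<^bsub>j,j+1\<^esub>, s\<^sub>j)\<close> that belong to the braid generators generate the semidirect product:
    their two components commute, so the \<open>m\<close>-th power is \<open>(0, s\<^sub>j)\<close>; these generate \<open>S\<^sub>n\<close>, and
    conjugating the remaining factor \<open>c e\<^bsub>j,j+1\<^esub>\<close> reaches all pairs (\<open>braid_elements_generate\<close>).
\<close>

section \<open>Walsh characters\<close>

definition walsh :: "nat set \<Rightarrow> nat set \<Rightarrow> 'a::comm_ring_1" where
  "walsh T D = (- 1) ^ card (T \<inter> D)"

lemma walsh_commute: "walsh T D = walsh D T"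
  by (simp add: walsh_def Int_commute)

lemma walsh_empty [simp]: "walsh T {} = 1"
  by (simp add: walsh_def)

lemma walsh_insert:
  assumes "finite D" "j \<notin> D"
  shows "walsh T (insert j D) = (if j \<in> T then - 1 else 1) * walsh T D"
  using assms by (auto simp: walsh_def)

lemma walsh_image:
  assumes "bij p"
  shows "walsh (p ` T) D = walsh T (inv' p ` D)"
proof -
  have "p ` T \<inter> D = p ` (T \<inter> inv' p ` D)"
    using assms by (force simp: bij_is_surj surj_f_inv_f bij_is_inj image_iff)
  then show ?thesis
    using card_image[OF inj_on_subset[OF bij_is_inj[OF assms] subset_UNIV]] by (simp add: walsh_def)
qed

lemma walsh_cong: "T \<inter> D = T' \<inter> D \<Longrightarrow> walsh T D = walsh T' D"
  by (simp add: walsh_def)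

lemma walsh_prod: "finite D \<Longrightarrow> walsh T D = (\<Prod>j\<in>D. if j \<in> T then - 1 else 1)"
  by (induction D rule: finite_induct) (simp_all add: walsh_insert)

text \<open>The functions \<open>walsh T\<close> are the characters of the group of subsets of \<open>A\<close> under symmetric
  difference. The sum factors over the elements of \<open>A\<close>, and the factor of an element that lies in only
  one of \<open>T\<close> and \<open>T'\<close> is \<open>1 - 1\<close>.\<close>
lemma walsh_orthogonal:
  assumes "finite A" "T \<subseteq> A" "T' \<subseteq> A"
  shows "(\<Sum>D\<in>Pow A. walsh T D * walsh T' D) = (if T = T' then 2 ^ card A else 0 :: 'a::comm_ring_1)"
proof -
  let ?e = "\<lambda>j. (if j \<in> T then - 1 else 1) * (if j \<in> T' then - 1 else 1) :: 'a"
  have "(\<Sum>D\<in>Pow A. walsh T D * walsh T' D) = (\<Sum>D\<in>Pow A. prod ?e D * (\<Prod>j\<in>A - D. 1))"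
    using assms(1) by (intro sum.cong HOL.refl) (auto simp: walsh_prod prod.distrib finite_subset)
  also have "\<dots> = (\<Prod>j\<in>A. ?e j + 1)"
    by (rule prod_add[OF assms(1), symmetric])
  also have "\<dots> = (if T = T' then 2 ^ card A else 0)"
  proof (cases "T = T'")
    case False
    then obtain j where "j \<in> A" "j \<in> T \<longleftrightarrow> j \<notin> T'" using assms(2,3) by blast
    then have "\<exists>j\<in>A. ?e j + 1 = 0" by (intro bexI[of _ j]) auto
    with assms(1) have "(\<Prod>j\<in>A. ?e j + 1) = 0" by (intro prod_zero) auto
    then show ?thesis using False by simp
  next
    case True
    then have "(\<Prod>j\<in>A. ?e j + 1) = (\<Prod>j\<in>A. 2)" by (intro prod.cong HOL.refl) auto
    then show ?thesis using True by simp
  qed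
  finally show ?thesis .
qed

section \<open>Monomial matrices in an orthonormal basis\<close>

text \<open>The vectors \<open>f t\<close> are the columns of a unitary matrix with columns labelled by \<open>I\<close>. Orthonormality
  gives the action of a monomial matrix on these vectors, and completeness says that a matrix is
  determined by this action.\<close>
locale orthonormal_columns =
  fixes d :: nat and I :: "'i set" and f :: "'i \<Rightarrow> nat \<Rightarrow> complex"
  assumes fin: "finite I"
    and orthonormal: "s \<in> I \<Longrightarrow> t \<in> I \<Longrightarrow> (\<Sum>x<d. cnj (f s x) * f t x) = (if s = t then 1 else 0)"
    and complete: "x < d \<Longrightarrow> y < d \<Longrightarrow> (\<Sum>t\<in>I. f t x * cnj (f t y)) = (if x = y then 1 else 0)"
begin

text \<open>The operator that sends \<open>f t\<close> to \<open>c t\<close> times \<open>f (p t)\<close>, written as a sum of rank-one operators.\<close>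
definition monomial_mat :: "('i \<Rightarrow> complex) \<Rightarrow> ('i \<Rightarrow> 'i) \<Rightarrow> complex mat" where
  "monomial_mat c p = mat d d (\<lambda>(x, y). \<Sum>t\<in>I. c t * f (p t) x * cnj (f t y))"

lemma monomial_mat_carrier [simp]: "monomial_mat c p \<in> carrier_mat d d"
  by (simp add: monomial_mat_def)

lemma monomial_mat_index:
  "x < d \<Longrightarrow> y < d \<Longrightarrow> monomial_mat c p $$ (x, y) = (\<Sum>t\<in>I. c t * f (p t) x * cnj (f t y))"
  by (simp add: monomial_mat_def)

lemma monomial_mat_cong:
  assumes "\<And>t. t \<in> I \<Longrightarrow> c t = c' t" "\<And>t. t \<in> I \<Longrightarrow> p t = p' t"
  shows "monomial_mat c p = monomial_mat c' p'"
  using assms by (auto simp: monomial_mat_def intro!: eq_matI sum.cong)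

lemma monomial_mat_one: "monomial_mat (\<lambda>t. 1) (\<lambda>t. t) = 1\<^sub>m d"
  by (rule eq_matI) (simp_all add: monomial_mat_def complete)

lemma monomial_mat_apply:
  assumes "x < d" "t \<in> I"
  shows "(\<Sum>y<d. monomial_mat c p $$ (x, y) * f t y) = c t * f (p t) x"
proof -
  have "(\<Sum>y<d. monomial_mat c p $$ (x, y) * f t y)
      = (\<Sum>y<d. \<Sum>s\<in>I. c s * f (p s) x * (cnj (f s y) * f t y))"
    using assms(1) by (intro sum.cong HOL.refl) (simp add: monomial_mat_index sum_distrib_right mult.assoc)
  also have "\<dots> = (\<Sum>s\<in>I. c s * f (p s) x * (\<Sum>y<d. cnj (f s y) * f t y))"
    by (subst sum.swap) (simp add: sum_distrib_left)
  also have "\<dots> = (\<Sum>s\<in>I. if s = t then c s * f (p s) x else 0)"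
    using assms(2) by (intro sum.cong HOL.refl) (simp add: orthonormal)
  finally show ?thesis using assms(2) fin by (simp add: sum.delta)
qed

lemma monomial_mat_mult:
  assumes "p' \<in> I \<rightarrow> I"
  shows "monomial_mat c p * monomial_mat c' p' = monomial_mat (\<lambda>t. c (p' t) * c' t) (p \<circ> p')"
proof (rule eq_matI)
  fix x y assume "x < dim_row (monomial_mat (\<lambda>t. c (p' t) * c' t) (p \<circ> p'))"
    "y < dim_col (monomial_mat (\<lambda>t. c (p' t) * c' t) (p \<circ> p'))"
  then have x: "x < d" and y: "y < d" by (simp_all add: monomial_mat_def)
  have "(monomial_mat c p * monomial_mat c' p') $$ (x, y)
      = (\<Sum>z<d. monomial_mat c p $$ (x, z) * monomial_mat c' p' $$ (z, y))"
    using x y by (simp add: monomial_mat_def scalar_prod_def atLeast0LessThan)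
  also have "\<dots> = (\<Sum>z<d. \<Sum>t\<in>I. c' t * cnj (f t y) * (monomial_mat c p $$ (x, z) * f (p' t) z))"
    using y by (intro sum.cong HOL.refl) (simp add: monomial_mat_index[of _ _ c'] sum_distrib_left mult_ac)
  also have "\<dots> = (\<Sum>t\<in>I. c' t * cnj (f t y) * (\<Sum>z<d. monomial_mat c p $$ (x, z) * f (p' t) z))"
    by (subst sum.swap) (simp add: sum_distrib_left)
  also have "\<dots> = (\<Sum>t\<in>I. c' t * cnj (f t y) * (c (p' t) * f (p (p' t)) x))"
    using x assms by (intro sum.cong HOL.refl) (subst monomial_mat_apply, auto)
  finally show "(monomial_mat c p * monomial_mat c' p') $$ (x, y)
      = monomial_mat (\<lambda>t. c (p' t) * c' t) (p \<circ> p') $$ (x, y)"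
    using x y by (simp add: monomial_mat_def mult_ac)
qed (simp_all add: monomial_mat_def)

lemma monomial_mat_eq_oneD:
  assumes "monomial_mat c p = 1\<^sub>m d" "t \<in> I" "p t \<in> I"
  shows "p t = t \<and> c t = 1"
proof -
  have eq: "f t x = c t * f (p t) x" if "x < d" for x
  proof -
    have "f t x = (\<Sum>y<d. 1\<^sub>m d $$ (x, y) * f t y)"
      using that by (simp add: sum.delta if_distrib[of "\<lambda>z. z * _"] cong: if_cong)
    also have "\<dots> = c t * f (p t) x"
      using monomial_mat_apply[OF that assms(2), of c p] by (simp only: assms(1))
    finally show ?thesis .
  qed
  have "(1::complex) = (\<Sum>x<d. cnj (f t x) * f t x)" using assms(2) by (simp add: orthonormal)
  also have "\<dots> = (\<Sum>x<d. c t * (cnj (f t x) * f (p t) x))"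
    by (intro sum.cong HOL.refl) (use eq in \<open>simp add: mult_ac\<close>)
  also have "\<dots> = c t * (if t = p t then 1 else 0)"
    using assms(2,3) by (simp add: orthonormal flip: sum_distrib_left)
  finally show ?thesis by (auto split: if_splits)
qed

lemma mat_eq_monomial_mat:
  assumes A: "A \<in> carrier_mat d d"
    and apply_eq: "\<And>t x. t \<in> I \<Longrightarrow> x < d \<Longrightarrow> (\<Sum>y<d. A $$ (x, y) * f t y) = c t * f (p t) x"
  shows "A = monomial_mat c p"
proof (rule eq_matI)
  fix x z assume "x < dim_row (monomial_mat c p)" "z < dim_col (monomial_mat c p)"
  then have x: "x < d" and z: "z < d" by (simp_all add: monomial_mat_def)
  have "A $$ (x, z) = (\<Sum>y<d. A $$ (x, y) * (\<Sum>t\<in>I. f t y * cnj (f t z)))"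
    using z by (simp add: complete sum.delta if_distrib[of "\<lambda>u. _ * u"] cong: if_cong)
  also have "\<dots> = (\<Sum>t\<in>I. (\<Sum>y<d. A $$ (x, y) * f t y) * cnj (f t z))"
    by (simp add: sum_distrib_left sum_distrib_right mult.assoc sum.swap[of _ I])
  also have "\<dots> = monomial_mat c p $$ (x, z)"
    using x z by (simp add: monomial_mat_def apply_eq)
  finally show "A $$ (x, z) = monomial_mat c p $$ (x, z)" .
qed (use A in \<open>auto simp: monomial_mat_def\<close>)

end

section \<open>The symmetric group acting on pairs\<close>

definition vertex_pairs :: "nat \<Rightarrow> nat set set" where
  "vertex_pairs n = {e. e \<subseteq> {1..n} \<and> card e = 2}"

definition num_pairs :: "nat \<Rightarrow> nat" where
  "num_pairs n = n * (n - 1) div 2"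

text \<open>The coordinates of \<open>\<int>\<^sub>m\<close> to the power \<open>n (n - 1) / 2\<close> are numbered, whereas \<open>S\<^sub>n\<close> acts naturally on the
  two-element subsets of \<open>{1..n}\<close>. An arbitrary enumeration of these subsets transports the action.\<close>
definition pair_enum :: "nat \<Rightarrow> nat \<Rightarrow> nat set" where
  "pair_enum n = (SOME f. bij_betw f {..<num_pairs n} (vertex_pairs n))"

definition pair_index :: "nat \<Rightarrow> nat set \<Rightarrow> nat" where
  "pair_index n = inv_into {..<num_pairs n} (pair_enum n)"

definition pair_perm :: "nat \<Rightarrow> (nat \<Rightarrow> nat) \<Rightarrow> nat \<Rightarrow> nat" where
  "pair_perm n \<pi> k = pair_index n (\<pi> ` pair_enum n k)"

lemma bij_betw_pair_enum: "bij_betw (pair_enum n) {..<num_pairs n} (vertex_pairs n)"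
proof -
  have "finite (vertex_pairs n)" by (simp add: vertex_pairs_def)
  moreover have "card (vertex_pairs n) = num_pairs n"
    using n_subsets[of "{1..n}" 2] by (simp add: vertex_pairs_def num_pairs_def choose_two)
  ultimately have "\<exists>f. bij_betw f {..<num_pairs n} (vertex_pairs n)"
    using ex_bij_betw_nat_finite[of "vertex_pairs n"] by (simp add: atLeast0LessThan)
  then show ?thesis unfolding pair_enum_def by (rule someI_ex)
qed

lemma pair_enum_vertex_pairs: "k < num_pairs n \<Longrightarrow> pair_enum n k \<in> vertex_pairs n"
  using bij_betw_pair_enum[of n] by (auto simp: bij_betw_def)

lemma pair_enum_subset: "k < num_pairs n \<Longrightarrow> pair_enum n k \<subseteq> {1..n}"
  using pair_enum_vertex_pairs[of k n] by (simp add: vertex_pairs_def)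

lemma pair_index_less: "e \<in> vertex_pairs n \<Longrightarrow> pair_index n e < num_pairs n"
  using bij_betw_pair_enum[of n] inv_into_into[of e "pair_enum n" "{..<num_pairs n}"]
  by (simp add: pair_index_def bij_betw_def)

lemma pair_enum_index: "e \<in> vertex_pairs n \<Longrightarrow> pair_enum n (pair_index n e) = e"
  unfolding pair_index_def using bij_betw_pair_enum by (rule bij_betw_inv_into_right)

lemma pair_index_enum: "k < num_pairs n \<Longrightarrow> pair_index n (pair_enum n k) = k"
  unfolding pair_index_def using bij_betw_pair_enum by (intro bij_betw_inv_into_left) auto

lemma pair_enum_eq_iff:
  "k < num_pairs n \<Longrightarrow> l < num_pairs n \<Longrightarrow> pair_enum n k = pair_enum n l \<longleftrightarrow> k = l"
  by (metis pair_index_enum)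

lemma vertex_pairs_image:
  assumes "\<pi> permutes {1..n}" "e \<in> vertex_pairs n"
  shows "\<pi> ` e \<in> vertex_pairs n"
proof -
  have "card (\<pi> ` e) = card e"
    by (rule card_image) (rule inj_on_subset[OF permutes_inj[OF assms(1)] subset_UNIV])
  moreover have "\<pi> ` e \<subseteq> {1..n}"
    using assms(2) image_mono[of e "{1..n}" \<pi>] permutes_image[OF assms(1)]
    by (simp add: vertex_pairs_def)
  ultimately show ?thesis using assms(2) by (simp add: vertex_pairs_def)
qed

lemma
  assumes "\<pi> permutes {1..n}" "k < num_pairs n"
  shows pair_perm_less: "pair_perm n \<pi> k < num_pairs n"
    and pair_enum_perm: "pair_enum n (pair_perm n \<pi> k) = \<pi> ` pair_enum n k"
  using assms pair_enum_vertex_pairs[THEN vertex_pairs_image[OF assms(1)]]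
  by (simp_all add: pair_perm_def pair_index_less pair_enum_index)

lemma pair_perm_id: "k < num_pairs n \<Longrightarrow> pair_perm n id k = k"
  by (simp add: pair_perm_def pair_index_enum)

lemma pair_perm_comp:
  assumes "\<tau> permutes {1..n}" "k < num_pairs n"
  shows "pair_perm n (\<pi> \<circ> \<tau>) k = pair_perm n \<pi> (pair_perm n \<tau> k)"
  using pair_enum_perm[OF assms] by (simp add: pair_perm_def[of n \<pi>] pair_perm_def[of n "\<pi> \<circ> \<tau>"] image_comp)

lemma pair_perm_inv:
  assumes "\<pi> permutes {1..n}" "k < num_pairs n"
  shows "pair_perm n (inv' \<pi>) (pair_perm n \<pi> k) = k"
  using pair_perm_comp[OF assms, of "inv' \<pi>"] permutes_inv_o(2)[OF assms(1)] assms(2)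
  by (simp add: pair_perm_id)

lemma bij_betw_pair_perm:
  assumes "\<pi> permutes {1..n}"
  shows "bij_betw (pair_perm n \<pi>) {..<num_pairs n} {..<num_pairs n}"
  using pair_perm_less[OF assms] pair_perm_less[OF permutes_inv[OF assms]]
    pair_perm_inv[OF assms] pair_perm_inv[OF permutes_inv[OF assms]]
  by (intro bij_betw_byWitness[of _ "pair_perm n (inv' \<pi>)"])
    (auto simp: permutes_inv_inv[OF assms])

abbreviation pair_group :: "nat \<Rightarrow> nat \<Rightarrow> (nat \<Rightarrow> int) monoid" where
  "pair_group m n \<equiv> cyclic_power m (num_pairs n)"

definition pair_action :: "nat \<Rightarrow> nat \<Rightarrow> (nat \<Rightarrow> nat) \<Rightarrow> (nat \<Rightarrow> int) \<Rightarrow> nat \<Rightarrow> int" where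
  "pair_action m n \<pi> =
    (\<lambda>a\<in>carrier (pair_group m n). \<lambda>k\<in>{..<num_pairs n}. a (pair_perm n (inv' \<pi>) k))"

lemma
  assumes "m > 0"
  shows cyclic_power_carrier: "carrier (cyclic_power m k) = {..<k} \<rightarrow>\<^sub>E {0..<int m}"
    and cyclic_power_mult: "a \<otimes>\<^bsub>cyclic_power m k\<^esub> b = (\<lambda>l\<in>{..<k}. (a l + b l) mod int m)"
    and cyclic_power_one: "\<one>\<^bsub>cyclic_power m k\<^esub> = (\<lambda>l\<in>{..<k}. 0)"
  using assms by (simp_all add: cyclic_power_def carrier_integer_mod_group)

lemma group_cyclic_power: "group (cyclic_power m k)"
  by (simp add: cyclic_power_def)

lemma pair_action_apply:
  "a \<in> carrier (pair_group m n) \<Longrightarrow> k < num_pairs n \<Longrightarrow>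
    pair_action m n \<pi> a k = a (pair_perm n (inv' \<pi>) k)"
  by (simp add: pair_action_def)

context
  fixes m n :: nat
  assumes m_pos: "m > 0"
begin

lemma pair_action_closed:
  assumes "\<pi> permutes {1..n}" "a \<in> carrier (pair_group m n)"
  shows "pair_action m n \<pi> a \<in> carrier (pair_group m n)"
  using assms(2) pair_perm_less[OF permutes_inv[OF assms(1)]]
  by (auto simp: pair_action_def cyclic_power_carrier[OF m_pos] PiE_iff)

text \<open>The permutation acts on a coordinate family through its inverse on the indices, which makes this a
  left action.\<close>
lemma pair_action_comp:
  assumes "\<pi> permutes {1..n}" "\<tau> permutes {1..n}" "a \<in> carrier (pair_group m n)"
  shows "pair_action m n (\<pi> \<circ> \<tau>) a = pair_action m n \<pi> (pair_action m n \<tau> a)"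
proof -
  have "inv' (\<pi> \<circ> \<tau>) = inv' \<tau> \<circ> inv' \<pi>"
    using assms(1,2) by (simp add: o_inv_distrib permutes_bij)
  then show ?thesis
    using assms(3) pair_action_closed[OF assms(2,3)] pair_perm_less[OF permutes_inv[OF assms(1)]]
    by (auto simp: pair_action_def pair_perm_comp[OF permutes_inv[OF assms(1)]] intro!: restrict_ext)
qed

lemma pair_action_id:
  assumes "a \<in> carrier (pair_group m n)"
  shows "pair_action m n id a = a"
proof -
  have "a \<in> extensional {..<num_pairs n}" using assms by (simp add: cyclic_power_carrier[OF m_pos] PiE_def)
  then show ?thesis
    using assms by (intro extensionalityI[of _ "{..<num_pairs n}"]) (auto simp: pair_action_def pair_perm_id)
qed

lemma pair_action_mult:
  assumes "\<pi> permutes {1..n}" "a \<in> carrier (pair_group m n)" "b \<in> carrier (pair_group m n)"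
  shows "pair_action m n \<pi> (a \<otimes>\<^bsub>pair_group m n\<^esub> b)
    = pair_action m n \<pi> a \<otimes>\<^bsub>pair_group m n\<^esub> pair_action m n \<pi> b"
proof -
  have "a \<otimes>\<^bsub>pair_group m n\<^esub> b \<in> carrier (pair_group m n)"
    using assms(2,3) group_cyclic_power by (metis group.is_monoid monoid.m_closed)
  then show ?thesis
    using assms(2,3) pair_perm_less[OF permutes_inv[OF assms(1)]]
    by (auto simp: pair_action_def cyclic_power_mult[OF m_pos] intro!: restrict_ext)
qed

lemma pair_action_auto:
  assumes "\<pi> permutes {1..n}"
  shows "pair_action m n \<pi> \<in> auto (pair_group m n)"
proof -
  let ?N = "carrier (pair_group m n)"
  have "bij_betw (pair_action m n \<pi>) ?N ?N"
    using pair_action_closed[OF assms] pair_action_closed[OF permutes_inv[OF assms]]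
      pair_action_comp[OF assms permutes_inv[OF assms], symmetric]
      pair_action_comp[OF permutes_inv[OF assms] assms, symmetric]
    by (intro bij_betw_byWitness[of _ "pair_action m n (inv' \<pi>)"])
      (auto simp: permutes_inv_o[OF assms] pair_action_id)
  moreover have "pair_action m n \<pi> \<in> extensional ?N" by (simp add: pair_action_def)
  ultimately show ?thesis
    using pair_action_closed[OF assms] pair_action_mult[OF assms]
    by (simp add: auto_def Bij_def hom_def Pi_iff)
qed

lemma pair_action_hom: "pair_action m n \<in> hom (sym_group n) (AutoGroup (pair_group m n))"
proof (rule homI)
  show "pair_action m n \<pi> \<in> carrier (AutoGroup (pair_group m n))" if "\<pi> \<in> carrier (sym_group n)" for \<pi>
    using that pair_action_auto by (simp add: AutoGroup_def sym_group_carrier)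
  show "pair_action m n (\<pi> \<otimes>\<^bsub>sym_group n\<^esub> \<tau>)
      = pair_action m n \<pi> \<otimes>\<^bsub>AutoGroup (pair_group m n)\<^esub> pair_action m n \<tau>"
    if "\<pi> \<in> carrier (sym_group n)" "\<tau> \<in> carrier (sym_group n)" for \<pi> \<tau>
  proof (rule extensionalityI[of _ "carrier (pair_group m n)"])
    have Bij: "pair_action m n \<pi> \<in> Bij (carrier (pair_group m n))"
      "pair_action m n \<tau> \<in> Bij (carrier (pair_group m n))"
      using that pair_action_auto by (auto simp: auto_def sym_group_carrier)
    have AG: "pair_action m n \<pi> \<otimes>\<^bsub>AutoGroup (pair_group m n)\<^esub> pair_action m n \<tau>
        = compose (carrier (pair_group m n)) (pair_action m n \<pi>) (pair_action m n \<tau>)"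
      using Bij by (simp add: AutoGroup_def BijGroup_def)
    show "pair_action m n (\<pi> \<otimes>\<^bsub>sym_group n\<^esub> \<tau>) \<in> extensional (carrier (pair_group m n))"
      by (simp add: pair_action_def)
    show "pair_action m n \<pi> \<otimes>\<^bsub>AutoGroup (pair_group m n)\<^esub> pair_action m n \<tau>
        \<in> extensional (carrier (pair_group m n))"
      unfolding AG by (rule compose_extensional)
    show "pair_action m n (\<pi> \<otimes>\<^bsub>sym_group n\<^esub> \<tau>) a
        = (pair_action m n \<pi> \<otimes>\<^bsub>AutoGroup (pair_group m n)\<^esub> pair_action m n \<tau>) a"
      if "a \<in> carrier (pair_group m n)" for a
      using that \<open>\<pi> \<in> carrier (sym_group n)\<close> \<open>\<tau> \<in> carrier (sym_group n)\<close>
      unfolding AG by (simp add: pair_action_comp sym_group_carrier sym_group_mult compose_eq)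
  qed
qed

end

section \<open>Generators of the semidirect product\<close>

lemma (in group) gword_evals_eq_generate:
  assumes "f \<in> X \<rightarrow> carrier G"
  shows "gword_eval G f ` gwords X = generate G (f ` X)"
proof (intro equalityI subsetI)
  fix a assume "a \<in> gword_eval G f ` gwords X"
  then obtain w where "w \<in> gwords X" "a = gword_eval G f w" by blast
  moreover have "gword_eval G f w \<in> generate G (f ` X)" if "w \<in> gwords X" for w
    using that
  proof (induction w)
    case (Cons l w)
    obtain x b where l: "l = (x, b)" by (cases l)
    have "x \<in> X" and w: "gword_eval G f w \<in> generate G (f ` X)"
      using Cons by (auto simp: l gwords_def)
    then have "(if b then f x else inv f x) \<in> generate G (f ` X)"
      by (auto intro: generate.incl generate.inv)
    then show ?case using generate.eng[OF _ w] by (simp add: l)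
  qed (simp add: generate.one)
  ultimately show "a \<in> generate G (f ` X)" by simp
next
  fix a assume "a \<in> generate G (f ` X)"
  then show "a \<in> gword_eval G f ` gwords X"
  proof induction
    case one
    have "[] \<in> gwords X" by (simp add: gwords_def)
    then show ?case by (metis gword_eval.simps(1) image_eqI)
  next
    case (incl h)
    then obtain x where "x \<in> X" "h = f x" by blast
    then have "[(x, True)] \<in> gwords X" "h = gword_eval G f [(x, True)]"
      using assms by (auto simp: gwords_def Pi_iff)
    then show ?case by blast
  next
    case (inv h)
    then obtain x where "x \<in> X" "h = f x" by blast
    then have "[(x, False)] \<in> gwords X" "inv h = gword_eval G f [(x, False)]"
      using assms by (auto simp: gwords_def Pi_iff)
    then show ?case by blast
  next
    case (eng h k)
    then obtain u v where "u \<in> gwords X" "v \<in> gwords X" "h = gword_eval G f u" "k = gword_eval G f v"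
      by blast
    then have "u @ v \<in> gwords X" "h \<otimes> k = gword_eval G f (u @ v)"
      using gword_eval_append[OF assms] by (auto simp: gwords_def)
    then show ?case by blast
  qed
qed

text \<open>A transposition of distant points is a conjugate of one of closer points by an adjacent
  transposition, and the transpositions generate the symmetric group.\<close>
lemma adjacent_transpositions_generate:
  assumes "\<pi> permutes {1..n}" and id: "id \<in> Q" and comp: "\<And>p q. p \<in> Q \<Longrightarrow> q \<in> Q \<Longrightarrow> p \<circ> q \<in> Q"
    and adj: "\<And>j. 1 \<le> j \<Longrightarrow> j < n \<Longrightarrow> transpose j (Suc j) \<in> Q"
  shows "\<pi> \<in> Q"
proof -
  have less: "transpose i (Suc (i + k)) \<in> Q" if "1 \<le> i" "i + k < n" for i k
    using that(2)
  proof (induction k)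
    case 0
    then show ?case using adj that(1) by simp
  next
    case (Suc k)
    let ?j = "Suc (i + k)"
    have "transpose i (Suc ?j) = transpose ?j (Suc ?j) \<circ> (transpose i ?j \<circ> transpose ?j (Suc ?j))"
      by (auto simp: fun_eq_iff transpose_def)
    moreover have "transpose ?j (Suc ?j) \<in> Q" "transpose i ?j \<in> Q" using Suc adj[of ?j] by simp_all
    ultimately show ?case by (simp only: comp add_Suc_right)
  qed
  have swap: "transpose a b \<in> Q" if "a \<in> {1..n}" "b \<in> {1..n}" "a \<noteq> b" for a b
  proof (cases "a < b")
    case True
    then show ?thesis using less[of a "b - Suc a"] that by simp
  next
    case False
    then show ?thesis using less[of b "a - Suc b"] that by (simp add: transpose_commute)
  qed
  from assms(1) finite_atLeastAtMost show ?thesis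
    by (induction rule: permutes_induct) (use id comp swap in blast)+
qed

lemma ex_permutes_pair:
  assumes "a \<in> S" "b \<in> S" "a \<noteq> b" "c \<in> S" "d \<in> S" "c \<noteq> d"
  shows "\<exists>\<pi>. \<pi> permutes S \<and> \<pi> a = c \<and> \<pi> b = d"
proof -
  let ?s = "transpose a c"
  let ?t = "transpose (?s b) d"
  have b: "?s b \<in> S" "?s b \<noteq> c" using assms by (auto simp: transpose_def)
  then have "(?t \<circ> ?s) permutes S"
    using assms by (intro permutes_compose permutes_swap_id) auto
  moreover have "(?t \<circ> ?s) a = c" "(?t \<circ> ?s) b = d" using assms b by auto
  ultimately show ?thesis by blast
qed

definition single_pair :: "nat \<Rightarrow> nat \<Rightarrow> nat \<Rightarrow> int \<Rightarrow> nat \<Rightarrow> int" where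
  "single_pair m n k t = (\<lambda>l\<in>{..<num_pairs n}. if l = k then t mod int m else 0)"

text \<open>The element of the semidirect product that corresponds to a braid generator. The parameter \<open>c\<close> is
  left open, because only its invertibility modulo \<open>m\<close> matters for generation.\<close>
definition braid_element :: "nat \<Rightarrow> nat \<Rightarrow> int \<Rightarrow> nat \<Rightarrow> (nat \<Rightarrow> int) \<times> (nat \<Rightarrow> nat)" where
  "braid_element m n c j =
    (single_pair m n (pair_index n {j, Suc j}) c, transpose j (Suc j))"

abbreviation pair_semidirect :: "nat \<Rightarrow> nat \<Rightarrow> ((nat \<Rightarrow> int) \<times> (nat \<Rightarrow> nat)) monoid" where
  "pair_semidirect m n \<equiv> semidirect_product (pair_group m n) (sym_group n) (pair_action m n)"

lemma adjacent_vertex_pair: "1 \<le> j \<Longrightarrow> j < n \<Longrightarrow> {j, Suc j} \<in> vertex_pairs n"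
  by (simp add: vertex_pairs_def)

lemma adjacent_transpose_permutes: "1 \<le> j \<Longrightarrow> j < n \<Longrightarrow> transpose j (Suc j) permutes {1..n}"
  by (rule permutes_swap_id) auto

lemma pair_perm_adjacent:
  assumes "1 \<le> j" "j < n"
  shows "pair_perm n (transpose j (Suc j)) (pair_index n {j, Suc j}) = pair_index n {j, Suc j}"
  using assms by (simp add: pair_perm_def pair_enum_index adjacent_vertex_pair insert_commute)

lemma pair_semidirect_mult:
  "(a, \<pi>) \<otimes>\<^bsub>pair_semidirect m n\<^esub> (b, \<tau>) = (a \<otimes>\<^bsub>pair_group m n\<^esub> pair_action m n \<pi> b, \<pi> \<circ> \<tau>)"
  by (simp add: semidirect_product_def sym_group_mult)

lemma pair_semidirect_carrier:
  "(a, \<pi>) \<in> carrier (pair_semidirect m n) \<longleftrightarrow> a \<in> carrier (pair_group m n) \<and> \<pi> permutes {1..n}"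
  by (simp add: semidirect_product_def sym_group_carrier)

lemma pair_semidirect_one: "\<one>\<^bsub>pair_semidirect m n\<^esub> = (\<one>\<^bsub>pair_group m n\<^esub>, id)"
  by (simp add: semidirect_product_def sym_group_one)

context
  fixes m n :: nat
  assumes m_pos: "m > 0"
begin

lemma single_pair_carrier: "single_pair m n k t \<in> carrier (pair_group m n)"
  using m_pos by (auto simp: single_pair_def cyclic_power_carrier[OF m_pos])

lemma single_pair_add:
  "single_pair m n k t \<otimes>\<^bsub>pair_group m n\<^esub> single_pair m n k t' = single_pair m n k (t + t')"
  by (auto simp: single_pair_def cyclic_power_mult[OF m_pos] mod_add_eq intro!: restrict_ext)

lemma single_pair_zero: "t mod int m = 0 \<Longrightarrow> single_pair m n k t = \<one>\<^bsub>pair_group m n\<^esub>"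
  by (auto simp: single_pair_def cyclic_power_one[OF m_pos])

lemma single_pair_mod_cong: "t mod int m = t' mod int m \<Longrightarrow> single_pair m n k t = single_pair m n k t'"
  by (simp only: single_pair_def)

lemma pair_action_single_pair:
  assumes "\<pi> permutes {1..n}" "k < num_pairs n"
  shows "pair_action m n \<pi> (single_pair m n k t) = single_pair m n (pair_perm n \<pi> k) t"
proof (rule extensionalityI[of _ "{..<num_pairs n}"])
  fix l assume l: "l \<in> {..<num_pairs n}"
  then have "pair_perm n (inv' \<pi>) l = k \<longleftrightarrow> l = pair_perm n \<pi> k"
    using pair_perm_inv[OF assms] pair_perm_inv[OF permutes_inv[OF assms(1)], of l]
    by (auto simp: permutes_inv_inv[OF assms(1)])
  then show "pair_action m n \<pi> (single_pair m n k t) l = single_pair m n (pair_perm n \<pi> k) t l"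
    using l pair_perm_less[OF permutes_inv[OF assms(1)], of l]
    by (simp add: pair_action_apply[OF single_pair_carrier]) (simp add: single_pair_def)
qed (use pair_action_closed[OF m_pos assms(1) single_pair_carrier, of k t] in
    \<open>simp_all add: cyclic_power_carrier[OF m_pos] PiE_iff single_pair_def\<close>)

lemma pair_action_one:
  assumes "\<pi> permutes {1..n}"
  shows "pair_action m n \<pi> \<one>\<^bsub>pair_group m n\<^esub> = \<one>\<^bsub>pair_group m n\<^esub>"
proof -
  interpret N: group "pair_group m n" by (rule group_cyclic_power)
  show ?thesis
    using pair_action_mult[OF m_pos assms N.one_closed N.one_closed]
      pair_action_closed[OF m_pos assms N.one_closed] N.r_cancel_one'
    by simp
qed

lemma group_pair_semidirect: "group (pair_semidirect m n)"
  by (intro group_semidirect_product group_cyclic_power sym_group_is_group pair_action_hom m_pos)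

lemma braid_element_carrier:
  "1 \<le> j \<Longrightarrow> j < n \<Longrightarrow> braid_element m n c j \<in> carrier (pair_semidirect m n)"
  using adjacent_transpose_permutes[of j n]
  by (simp add: braid_element_def pair_semidirect_carrier single_pair_carrier)

text \<open>The transposition of \<open>j\<close> and \<open>j + 1\<close> fixes the pair \<open>{j, j + 1}\<close>, so the two components of a
  generator commute and its powers are computed componentwise. As \<open>m\<close> is odd, the \<open>m\<close>-th power is the
  bare transposition. Hence the generated subgroup contains all permutations, then the multiples of
  \<open>c\<close> at one pair, by conjugation those at every pair, and by invertibility of \<open>c\<close> everything.\<close>
lemma braid_elements_generate:
  assumes m: "odd m" and n: "n \<ge> 2" and d: "c * d mod int m = 1 mod int m"
  shows "generate (pair_semidirect m n) (braid_element m n c ` {1..<n}) = carrier (pair_semidirect m n)"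
proof -
  let ?K = "pair_semidirect m n" and ?N = "pair_group m n"
  interpret K: group ?K by (rule group_pair_semidirect)
  interpret N: group ?N by (rule group_cyclic_power)
  define S where "S = generate ?K (braid_element m n c ` {1..<n})"
  have gens: "braid_element m n c ` {1..<n} \<subseteq> carrier ?K" using braid_element_carrier by auto
  have S_carrier: "a \<in> carrier ?N" "\<pi> permutes {1..n}" if "(a, \<pi>) \<in> S" for a \<pi>
    using that K.generate_incl[OF gens] by (auto simp: S_def pair_semidirect_carrier)
  have S_one: "(\<one>\<^bsub>?N\<^esub>, id) \<in> S"
    using generate.one[of ?K] by (simp add: S_def pair_semidirect_one)
  have S_mult: "(a \<otimes>\<^bsub>?N\<^esub> pair_action m n \<pi> b, \<pi> \<circ> \<tau>) \<in> S" if "(a, \<pi>) \<in> S" "(b, \<tau>) \<in> S" for a b \<pi> \<tau>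
    using generate.eng[OF that[unfolded S_def]] by (simp add: pair_semidirect_mult S_def)
  have S_gen: "(single_pair m n (pair_index n {j, Suc j}) c, transpose j (Suc j)) \<in> S"
    if "1 \<le> j" "j < n" for j
    using that generate.incl[of "braid_element m n c j" "braid_element m n c ` {1..<n}" ?K]
    by (simp add: S_def braid_element_def)
  have S_adj: "(\<one>\<^bsub>?N\<^esub>, transpose j (Suc j)) \<in> S" if j: "1 \<le> j" "j < n" for j
  proof -
    let ?k = "pair_index n {j, Suc j}" and ?s = "transpose j (Suc j)"
    have k: "?k < num_pairs n" using j by (simp add: pair_index_less adjacent_vertex_pair)
    have fix_k: "pair_action m n ?s (single_pair m n ?k t) = single_pair m n ?k t" for t
      using j by (simp add: pair_action_single_pair[OF adjacent_transpose_permutes k] pair_perm_adjacent)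
    have pow: "(single_pair m n ?k (int q * c), ?s ^^ q) \<in> S" for q
    proof (induction q)
      case 0
      then show ?case using S_one by (simp add: single_pair_zero id_def)
    next
      case (Suc q)
      have "c + int q * c = int (Suc q) * c" by (simp add: algebra_simps)
      with S_mult[OF S_gen[OF j] Suc.IH] show ?case
        by (simp only: fix_k single_pair_add funpow.simps(2))
    qed
    have "?s ^^ (2 * q) = id" for q
      by (induction q) (simp_all add: fun_eq_iff)
    moreover obtain q where "m = Suc (2 * q)" using m by (auto elim: oddE)
    ultimately have "?s ^^ m = ?s" by simp
    then show ?thesis using pow[of m] by (simp add: single_pair_zero)
  qed
  have S_perm: "(\<one>\<^bsub>?N\<^esub>, \<pi>) \<in> S" if "\<pi> permutes {1..n}" for \<pi>
  proof -
    have "\<pi> \<in> {\<pi>. (\<one>\<^bsub>?N\<^esub>, \<pi>) \<in> S}"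
      using that
    proof (rule adjacent_transpositions_generate)
      fix p q assume "p \<in> {\<pi>. (\<one>\<^bsub>?N\<^esub>, \<pi>) \<in> S}" "q \<in> {\<pi>. (\<one>\<^bsub>?N\<^esub>, \<pi>) \<in> S}"
      then show "p \<circ> q \<in> {\<pi>. (\<one>\<^bsub>?N\<^esub>, \<pi>) \<in> S}"
        using S_mult[of "\<one>\<^bsub>?N\<^esub>" p "\<one>\<^bsub>?N\<^esub>" q] S_carrier(2) by (simp add: pair_action_one)
    qed (use S_one S_adj in auto)
    then show ?thesis by simp
  qed
  have S_first: "(single_pair m n (pair_index n {1, 2}) c, id) \<in> S"
    using S_mult[OF S_gen[of 1] S_adj[of 1]] n adjacent_transpose_permutes[of 1 n]
    by (simp add: pair_action_one single_pair_carrier numeral_2_eq_2)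
  have S_unit: "(single_pair m n k c, id) \<in> S" if k: "k < num_pairs n" for k
  proof -
    have k0: "{1, 2} \<in> vertex_pairs n" using n by (simp add: vertex_pairs_def)
    from pair_enum_vertex_pairs[OF k] obtain a b where ab: "pair_enum n k = {a, b}" "a \<noteq> b" "{a, b} \<subseteq> {1..n}"
      by (auto simp: vertex_pairs_def card_2_iff)
    then obtain \<pi> where \<pi>: "\<pi> permutes {1..n}" "\<pi> 1 = a" "\<pi> 2 = b"
      using n ex_permutes_pair[of 1 "{1..n}" 2 a b] by auto
    have "pair_perm n \<pi> (pair_index n {1, 2}) = k"
      using \<pi> ab pair_index_enum[OF k]
      by (simp add: pair_perm_def pair_enum_index[OF k0] del: One_nat_def)
    then have "(single_pair m n k c, \<pi>) \<in> S"
      using S_mult[OF S_perm[OF \<pi>(1)] S_first]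
      by (simp add: pair_action_single_pair[OF \<pi>(1) pair_index_less[OF k0]] single_pair_carrier
          del: One_nat_def)
    from S_mult[OF this S_perm[OF permutes_inv[OF \<pi>(1)]]] show ?thesis
      by (simp add: pair_action_one[OF \<pi>(1)] permutes_inv_o[OF \<pi>(1)] single_pair_carrier)
  qed
  define A where "A = {a. (a, id) \<in> S}"
  have A_one: "\<one>\<^bsub>?N\<^esub> \<in> A" using S_one by (simp add: A_def)
  have A_mult: "a \<otimes>\<^bsub>?N\<^esub> b \<in> A" if "a \<in> A" "b \<in> A" for a b
    using that S_mult[of a id b id] S_carrier(1)[of b id] by (simp add: A_def pair_action_id[OF m_pos])
  have A_single: "single_pair m n k t \<in> A" if k: "k < num_pairs n" for k t
  proof -
    have mult: "single_pair m n k (int q * c) \<in> A" for q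
    proof (induction q)
      case 0
      then show ?case using A_one by (simp add: single_pair_zero)
    next
      case (Suc q)
      have "single_pair m n k c \<in> A" using S_unit[OF k] by (simp add: A_def)
      from A_mult[OF this Suc.IH] show ?case by (simp add: single_pair_add algebra_simps)
    qed
    \<comment> \<open>a multiple of \<open>c\<close> that is congruent to \<open>t\<close>\<close>
    define q where "q = nat (t * d mod int m)"
    have "int q = t * d mod int m" using m_pos by (simp add: q_def)
    then have "int q * c mod int m = t * (c * d mod int m) mod int m"
      by (simp add: mod_mult_left_eq mod_mult_right_eq mult_ac)
    also have "\<dots> = t mod int m" by (simp add: d mod_mult_right_eq)
    finally show ?thesis using mult[of q] single_pair_mod_cong by metis
  qed
  have S_translation: "(a, id) \<in> S" if a: "a \<in> carrier ?N" for a
  proof -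
    \<comment> \<open>\<open>a\<close> is assembled one coordinate at a time\<close>
    define b where "b L = (\<lambda>l\<in>{..<num_pairs n}. if l < L then a l else 0)" for L
    have "L \<le> num_pairs n \<Longrightarrow> b L \<in> A" for L
    proof (induction L)
      case 0
      have "b 0 = \<one>\<^bsub>?N\<^esub>" by (simp add: b_def cyclic_power_one[OF m_pos])
      then show ?case using A_one by simp
    next
      case (Suc L)
      have "b L \<otimes>\<^bsub>?N\<^esub> single_pair m n L (a L) = b (Suc L)"
        using a by (auto simp: b_def single_pair_def cyclic_power_mult[OF m_pos]
            cyclic_power_carrier[OF m_pos] PiE_iff less_Suc_eq intro!: restrict_ext)
      then show ?case using A_mult[OF Suc.IH A_single[of L "a L"]] Suc.prems by simp
    qed
    then have "b (num_pairs n) \<in> A" by simp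
    moreover have "b (num_pairs n) = restrict a {..<num_pairs n}"
      unfolding b_def by (rule restrict_ext) simp
    moreover have "restrict a {..<num_pairs n} = a"
      using a by (simp add: cyclic_power_carrier[OF m_pos] PiE_iff extensional_restrict)
    ultimately show ?thesis by (simp add: A_def)
  qed
  have "x \<in> S" if "x \<in> carrier ?K" for x
  proof -
    obtain a \<pi> where x: "x = (a, \<pi>)" by (cases x)
    with that have "a \<in> carrier ?N" "\<pi> permutes {1..n}" by (simp_all add: pair_semidirect_carrier)
    then show ?thesis
      using S_mult[OF S_translation S_perm, of a \<pi>]
      by (simp add: x pair_action_id[OF m_pos N.one_closed])
  qed
  then show ?thesis using K.generate_incl[OF gens] by (auto simp: S_def)
qed

end

section \<open>Jump coordinates and the eigenbasis\<close>

text \<open>Bits are counted from the lowest one. Index \<open>0\<close> records the lowest bit itself, so that the set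
  determines the bit string; the generators only flip inner bits and never change it.\<close>
definition jump_set :: "nat \<Rightarrow> nat \<Rightarrow> nat set" where
  "jump_set n x = {j \<in> {0..n}. if j = 0 then bit x 0 else bit x (j - 1) \<noteq> bit x j}"

lemma jump_set_subset: "jump_set n x \<subseteq> {0..n}"
  by (auto simp: jump_set_def)

lemma bij_betw_jump_set: "bij_betw (jump_set n) {..<2 ^ (n + 1)} (Pow {0..n})"
proof -
  have inj: "inj_on (jump_set n) {..<2 ^ (n + 1)}"
  proof (rule inj_onI)
    fix x y :: nat assume x: "x \<in> {..<2 ^ (n + 1)}" and y: "y \<in> {..<2 ^ (n + 1)}"
      and eq: "jump_set n x = jump_set n y"
    have low: "j \<le> n \<Longrightarrow> bit x j = bit y j" for j
    proof (induction j)
      case 0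
      have "0 \<in> jump_set n x \<longleftrightarrow> 0 \<in> jump_set n y" using eq by simp
      then show ?case by (simp add: jump_set_def)
    next
      case (Suc j)
      have "Suc j \<in> jump_set n x \<longleftrightarrow> Suc j \<in> jump_set n y" using eq by simp
      moreover have "bit x j = bit y j" using Suc by simp
      ultimately show ?case using Suc.prems by (auto simp: jump_set_def)
    qed
    have "take_bit (n + 1) x = take_bit (n + 1) y"
      by (rule bit_eqI) (auto simp: bit_take_bit_iff low)
    moreover have "take_bit (n + 1) x = x" "take_bit (n + 1) y = y"
      using x y by (simp_all add: take_bit_nat_eq_self del: power_Suc)
    ultimately show "x = y" by simp
  qed
  moreover have "jump_set n ` {..<2 ^ (n + 1)} = Pow {0..n}"
  proof (rule card_subset_eq)
    show "jump_set n ` {..<2 ^ (n + 1)} \<subseteq> Pow {0..n}" using jump_set_subset by blast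
    show "card (jump_set n ` {..<2 ^ (n + 1)}) = card (Pow {0..n})"
      using inj by (simp add: card_image card_Pow)
  qed simp
  ultimately show ?thesis by (simp add: bij_betw_def)
qed

lemma jump_set_flip_bit:
  assumes "j \<noteq> 0" "j < n"
  shows "jump_set n (flip_bit j x) = {l. (l \<in> jump_set n x) \<noteq> (l \<in> {j, Suc j})}"
proof (rule Set.set_eqI)
  fix l
  show "l \<in> jump_set n (flip_bit j x) \<longleftrightarrow> l \<in> {l. (l \<in> jump_set n x) \<noteq> (l \<in> {j, Suc j})}"
    using assms by (cases l) (auto simp: jump_set_def bit_flip_bit_iff)
qed

text \<open>The vector with components \<open>1\<close> and \<open>\<i> y\<close> is the eigenvector of the Pauli matrix \<open>Y\<close> for the
  eigenvalue \<open>y = \<plusminus> 1\<close>, and that with components \<open>1\<close> and \<open>y\<close> is the one of \<open>X\<close>. For \<open>m = 3\<close> the sign of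
  \<open>y\<close> alternates with the position. It turns the signed swap that \<open>\<nu> = - 1\<close> produces into a plain
  swap. In both cases the phases \<open>g\<close> satisfy \<open>g\<^sub>j g\<^sub>j = - \<nu>\<close> and \<open>g\<^bsub>j + 1\<^esub> = \<nu> g\<^sub>j\<close>, which is what
  \<open>sigma_op_eigenbasis\<close> uses.\<close>
definition jump_phase :: "nat \<Rightarrow> nat \<Rightarrow> complex" where
  "jump_phase m j = (if m = 3 then (- 1) ^ j else \<i>)"

text \<open>The product over the jump positions of the normalised eigenvectors, with eigenvalue \<open>- 1\<close> exactly
  at the positions in \<open>T\<close>.\<close>
definition eigenbasis :: "nat \<Rightarrow> nat \<Rightarrow> nat set \<Rightarrow> nat \<Rightarrow> complex" where
  "eigenbasis m n T x =
    (\<Prod>j\<in>jump_set n x. jump_phase m j) * walsh T (jump_set n x) / complex_of_real (sqrt (2 ^ (n + 1)))"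

lemma jump_phase_norm: "(\<Prod>j\<in>D. jump_phase m j) * cnj (\<Prod>j\<in>D. jump_phase m j) = 1"
proof -
  have "(\<Prod>j\<in>D. jump_phase m j) * cnj (\<Prod>j\<in>D. jump_phase m j)
      = (\<Prod>j\<in>D. jump_phase m j * cnj (jump_phase m j))"
    by (simp add: prod.distrib)
  also have "\<dots> = 1"
    by (rule prod.neutral) (simp add: jump_phase_def flip: power_mult_distrib)
  finally show ?thesis .
qed

lemma walsh_cnj [simp]: "cnj (walsh T D) = walsh T D"
  by (simp add: walsh_def)

text \<open>Up to unit phases this is the matrix of Walsh characters of the jump sets, and the jump sets run
  through all subsets of \<open>{0..n}\<close>.\<close>
lemma eigenbasis_orthonormal_columns:
  "orthonormal_columns (2 ^ (n + 1)) (Pow {0..n}) (eigenbasis m n)"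
proof
  let ?N = "2 ^ (n + 1) :: nat" and ?r = "complex_of_real (sqrt (2 ^ (n + 1)))"
  let ?G = "\<lambda>D. \<Prod>j\<in>D. jump_phase m j"
  have r: "?r * ?r = 2 ^ (n + 1)"
    by (metis of_real_mult of_real_numeral of_real_power real_sqrt_mult_self abs_of_nonneg
        zero_le_numeral zero_le_power)
  show "finite (Pow {0..n})" by simp
  show "(\<Sum>x<?N. cnj (eigenbasis m n S x) * eigenbasis m n T x) = (if S = T then 1 else 0)"
    if "S \<in> Pow {0..n}" "T \<in> Pow {0..n}" for S T
  proof -
    have "cnj (eigenbasis m n S x) * eigenbasis m n T x
        = walsh S (jump_set n x) * walsh T (jump_set n x) / 2 ^ (n + 1)" for x
    proof -
      let ?D = "jump_set n x"
      have "cnj (eigenbasis m n S x) * eigenbasis m n T x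
          = (?G ?D * cnj (?G ?D)) * (walsh S ?D * walsh T ?D) / (?r * ?r)"
        by (simp add: eigenbasis_def del: cnj_prod)
      then show ?thesis by (simp only: jump_phase_norm r mult_1)
    qed
    then have "(\<Sum>x<?N. cnj (eigenbasis m n S x) * eigenbasis m n T x)
        = (\<Sum>x<?N. walsh S (jump_set n x) * walsh T (jump_set n x)) / 2 ^ (n + 1)"
      by (simp only: sum_divide_distrib)
    also have "\<dots> = (\<Sum>D\<in>Pow {0..n}. walsh S D * walsh T D) / 2 ^ (n + 1)"
      by (subst sum.reindex_bij_betw[OF bij_betw_jump_set, of "\<lambda>D. walsh S D * walsh T D"]) simp
    also have "\<dots> = (if S = T then 1 else 0)"
      using that by (simp add: walsh_orthogonal)
    finally show ?thesis .
  qed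
  show "(\<Sum>T\<in>Pow {0..n}. eigenbasis m n T x * cnj (eigenbasis m n T y)) = (if x = y then 1 else 0)"
    if "x < ?N" "y < ?N" for x y
  proof -
    let ?D = "jump_set n x" and ?E = "jump_set n y"
    have "eigenbasis m n T x * cnj (eigenbasis m n T y)
        = ?G ?D * cnj (?G ?E) / 2 ^ (n + 1) * (walsh ?D T * walsh ?E T)" for T
    proof -
      have "eigenbasis m n T x * cnj (eigenbasis m n T y)
          = ?G ?D * cnj (?G ?E) / (?r * ?r) * (walsh ?D T * walsh ?E T)"
        by (simp add: eigenbasis_def walsh_commute[of T] del: cnj_prod)
      then show ?thesis by (simp only: r)
    qed
    then have "(\<Sum>T\<in>Pow {0..n}. eigenbasis m n T x * cnj (eigenbasis m n T y))
        = ?G ?D * cnj (?G ?E) / 2 ^ (n + 1) * (\<Sum>T\<in>Pow {0..n}. walsh ?D T * walsh ?E T)"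
      by (simp only: sum_distrib_left)
    also have "\<dots> = ?G ?D * cnj (?G ?E) * (if ?D = ?E then 1 else 0)"
      by (simp add: walsh_orthogonal jump_set_subset del: cnj_prod)
    also have "\<dots> = (if ?D = ?E then 1 else 0)" using jump_phase_norm by simp
    also have "?D = ?E \<longleftrightarrow> x = y"
      using that bij_betw_jump_set[of n] by (auto simp: bij_betw_def inj_on_def)
    finally show ?thesis .
  qed
qed

section \<open>The braid generators in the eigenbasis\<close>

definition twist_sign :: "nat \<Rightarrow> (nat \<Rightarrow> nat) \<Rightarrow> complex" where
  "twist_sign m \<pi> = (if m = 3 then 1 else of_int (sign \<pi>))"

text \<open>For \<open>m \<ge> 5\<close> the coefficient \<open>exp (\<mp> \<i> \<pi> / m)\<close> of a generator in the eigenbasis has even order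
  \<open>2 m\<close>. It is the negative of \<open>exp (\<plusminus> 2 \<pi> \<i> c / m)\<close> with \<open>c = (m - 1) / 2\<close>, and the factor \<open>- 1\<close> goes
  into the sign character \<open>twist_sign\<close>. For \<open>m = 3\<close> the coefficients already have order \<open>m\<close>.\<close>
definition braid_exponent :: "nat \<Rightarrow> int" where
  "braid_exponent m = (if m = 3 then - 1 else (int m - 1) div 2)"

definition unit_root :: "nat \<Rightarrow> int \<Rightarrow> complex" where
  "unit_root m q = cis (2 * pi * of_int q / real m)"

lemma braid_exponent_inverse:
  assumes "odd m"
  shows "\<exists>d. braid_exponent m * d mod int m = 1 mod int m"
proof (cases "m = 3")
  case True
  then show ?thesis by (intro exI[of _ "- 1"]) (simp add: braid_exponent_def)
next
  case False
  from assms obtain k where "m = 2 * k + 1" by (elim oddE)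
  \<comment> \<open>\<open>2 c = m - 1\<close>, so \<open>- 2\<close> is inverse to \<open>c\<close>\<close>
  then have "braid_exponent m * (- 2) = 1 + (- 1) * int m"
    using False by (simp add: braid_exponent_def)
  then have "braid_exponent m * (- 2) mod int m = 1 mod int m"
    by (metis mod_mult_self1)
  then show ?thesis by blast
qed

lemma unit_root_braid_exponent:
  assumes "odd m" "m \<ge> 3" "y = 1 \<or> y = - 1" "j \<noteq> l"
  shows "twist_sign m (transpose j l) * unit_root m (braid_exponent m * y)
    = (if m = 3 then - 1 else 1) * complex_of_real (cos (pi / real m))
      - \<i> * complex_of_real (sin (pi / real m)) * of_int y"
proof (cases "m = 3")
  case True
  have "cos (2 * pi / 3) = - 1 / 2" "sin (2 * pi / 3) = sqrt 3 / 2"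
    using cos_double[of "pi / 3"] sin_double[of "pi / 3"]
    by (simp_all add: cos_60 sin_60 power2_eq_square)
  with True assms(3) show ?thesis
    by (auto simp: twist_sign_def unit_root_def braid_exponent_def cos_60 sin_60 complex_eq_iff)
next
  case False
  from assms(1) obtain k where k: "m = 2 * k + 1" by (elim oddE)
  have c: "braid_exponent m = int k" using False k by (simp add: braid_exponent_def)
  have "pi - pi / real m = pi * (real m - 1) / real m" using assms(2) by (simp add: field_simps)
  then have "2 * pi * real_of_int (braid_exponent m) / real m = pi - pi / real m"
    unfolding c using k by simp
  moreover have "2 * pi * real_of_int (braid_exponent m * y) / real m
      = of_int y * (2 * pi * real_of_int (braid_exponent m) / real m)"
    by simp
  ultimately have "2 * pi * real_of_int (braid_exponent m * y) / real m = of_int y * (pi - pi / real m)"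
    by simp
  then have "unit_root m (braid_exponent m * y) = cis (of_int y * (pi - pi / real m))"
    by (simp only: unit_root_def)
  then show ?thesis
    using False assms(3,4)
    by (auto simp: twist_sign_def sign_swap_id complex_eq_iff cos_diff sin_diff)
qed

text \<open>A generator mixes the values of a basis vector at two bit strings, whose jump sets differ exactly at
  the positions \<open>j\<close> and \<open>j + 1\<close>. The four identities treat the four possibilities for which of the two
  positions lie in the jump set of the first string. Here \<open>v\<close> and \<open>w\<close> are the signs of \<open>T\<close> at \<open>j\<close> and
  \<open>j + 1\<close>, \<open>g\<close> and \<open>h\<close> the phases there, \<open>n\<close> stands for \<open>\<nu>\<close> and \<open>F\<close> collects the other positions.\<close>
lemma
  fixes v w g h n C F t :: complex
  assumes "v * v = 1" "w * w = 1" "g * h = - 1" "n * g = h" "n * h = g"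
  shows exchange_both: "n * C * (F * (g * v) * (h * w)) + t * F = (n * C - t * (v * w)) * (F * (g * w) * (h * v))"
    and exchange_left: "C * (F * (h * w)) - t * (F * (g * v)) = (n * C - t * (v * w)) * (F * (g * w))"
    and exchange_right: "C * (F * (g * v)) - t * (F * (h * w)) = (n * C - t * (v * w)) * (F * (h * v))"
    and exchange_neither: "n * C * F + t * (F * (g * v) * (h * w)) = (n * C - t * (v * w)) * F"
proof -
  have "(n * C - t * (v * w)) * (F * (g * w) * (h * v))
      = n * C * F * (g * h) * (v * w) - t * F * (g * h) * (v * v) * (w * w)"
    "n * C * (F * (g * v) * (h * w)) + t * F = n * C * F * (g * h) * (v * w) + t * F"
    by (simp_all add: algebra_simps)
  then show "n * C * (F * (g * v) * (h * w)) + t * F = (n * C - t * (v * w)) * (F * (g * w) * (h * v))"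
    by (simp add: assms)
  have "(n * C - t * (v * w)) * (F * (g * w)) = C * F * (n * g) * w - t * F * g * v * (w * w)"
    by (simp add: algebra_simps)
  then show "C * (F * (h * w)) - t * (F * (g * v)) = (n * C - t * (v * w)) * (F * (g * w))"
    by (simp add: assms)
  have "(n * C - t * (v * w)) * (F * (h * v)) = C * F * (n * h) * v - t * F * h * w * (v * v)"
    by (simp add: algebra_simps)
  then show "C * (F * (g * v)) - t * (F * (h * w)) = (n * C - t * (v * w)) * (F * (h * v))"
    by (simp add: assms)
  have "t * (F * (g * v) * (h * w)) = t * F * (g * h) * (v * w)" by (simp add: algebra_simps)
  then show "n * C * F + t * (F * (g * v) * (h * w)) = (n * C - t * (v * w)) * F"
    by (simp add: assms algebra_simps)
qed

text \<open>The operator mixes the values at \<open>x\<close> and at the string with bit \<open>p + 1\<close> flipped, that is, with jumps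
  \<open>p + 1\<close> and \<open>p + 2\<close> flipped. The contributions of the other jump positions to these values and to those
  of the permuted basis vector are the same factor \<open>F\<close>, and the rest is one of the four \<open>exchange\<close>
  identities.\<close>
lemma sigma_op_eigenbasis:
  assumes m: "odd m" "m \<ge> 3" and p: "p + 2 \<le> n"
  defines "s \<equiv> transpose (Suc p) (Suc (Suc p))"
  shows "sigma_op m p (eigenbasis m n T) x =
    twist_sign m s * unit_root m (braid_exponent m * walsh T {Suc p, Suc (Suc p)})
      * eigenbasis m n (s ` T) x"
proof -
  define j where "j = Suc p"
  define D where "D = jump_set n x - {j, Suc j}"
  define u :: "nat \<Rightarrow> complex" where "u = (\<lambda>l. if l \<in> T then - 1 else 1)"
  define g where "g = jump_phase m j"
  define g' where "g' = jump_phase m (Suc j)"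
  define \<nu> :: complex where "\<nu> = (if m = 3 then - 1 else 1)"
  define C where "C = complex_of_real (cos (pi / real m))"
  define S where "S = complex_of_real (sin (pi / real m))"
  define F where "F = prod (jump_phase m) D * walsh T D / complex_of_real (sqrt (2 ^ (n + 1)))"
  have s: "s = transpose j (Suc j)" by (simp add: s_def j_def)
  have D: "finite D" "j \<notin> D" "Suc j \<notin> D"
    using finite_subset[OF jump_set_subset] by (auto simp: D_def)
  have j: "j \<noteq> 0" "j < n" using p by (auto simp: j_def)
  have sT: "j \<in> s ` T \<longleftrightarrow> Suc j \<in> T" "Suc j \<in> s ` T \<longleftrightarrow> j \<in> T"
    by (auto simp: s image_iff transpose_def)
  have sD: "walsh (s ` T) D = (walsh T D :: complex)"
    using D(2,3) by (intro walsh_cong) (auto simp: s image_iff transpose_def)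
  have flip: "jump_set n (flip_bit j x) = {l. (l \<in> jump_set n x) \<noteq> (l \<in> {j, Suc j})}"
    by (rule jump_set_flip_bit[OF j])
  have eig: "eigenbasis m n T' y = F * (if j \<in> jump_set n y then g * (if j \<in> T' then - 1 else 1) else 1)
      * (if Suc j \<in> jump_set n y then g' * (if Suc j \<in> T' then - 1 else 1) else 1)"
    if "jump_set n y - {j, Suc j} = D" "walsh T' D = (walsh T D :: complex)" for T' y
  proof -
    have "jump_set n y = (if j \<in> jump_set n y then {j} else {}) \<union>
        (if Suc j \<in> jump_set n y then {Suc j} else {}) \<union> D"
      using that(1) by auto
    then consider "jump_set n y = D" | "jump_set n y = insert j D" | "jump_set n y = insert (Suc j) D"
      | "jump_set n y = insert j (insert (Suc j) D)"
      by (auto split: if_splits)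
    then show ?thesis
      using D by cases (simp_all add: eigenbasis_def F_def g_def g'_def walsh_insert that(2))
  qed
  have eig_x: "eigenbasis m n T x = F * (if j \<in> jump_set n x then g * u j else 1)
      * (if Suc j \<in> jump_set n x then g' * u (Suc j) else 1)"
    by (subst eig) (simp_all add: D_def u_def)
  have eig_flip: "eigenbasis m n T (flip_bit j x) = F * (if j \<notin> jump_set n x then g * u j else 1)
      * (if Suc j \<notin> jump_set n x then g' * u (Suc j) else 1)"
    by (subst eig) (auto simp: D_def u_def flip)
  have eig_s: "eigenbasis m n (s ` T) x = F * (if j \<in> jump_set n x then g * u (Suc j) else 1)
      * (if Suc j \<in> jump_set n x then g' * u j else 1)"
    by (subst eig) (simp_all add: D_def[symmetric] sD sT u_def)

  have walsh_u: "of_int (walsh T {j, Suc j}) = u j * u (Suc j)"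
    by (simp add: walsh_insert u_def)
  have "walsh T {j, Suc j} = (1 :: int) \<or> walsh T {j, Suc j} = (- 1 :: int)"
    by (simp add: walsh_insert)
  then have root: "twist_sign m s * unit_root m (braid_exponent m * walsh T {j, Suc j})
      = \<nu> * C - \<i> * S * (u j * u (Suc j))"
    using unit_root_braid_exponent[OF m, of "walsh T {j, Suc j}" j "Suc j"]
    by (simp add: walsh_u s \<nu>_def C_def S_def)
  have phases: "g' = \<nu> * g" "g * g = - \<nu>" "\<nu> * \<nu> = 1"
    by (auto simp: g_def g'_def \<nu>_def jump_phase_def simp flip: power2_eq_square power_mult)
  have bits: "bit x (p + 2) = bit x p \<longleftrightarrow> (j \<in> jump_set n x \<longleftrightarrow> Suc j \<in> jump_set n x)"
    using p by (auto simp: jump_set_def j_def)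
  have "sigma_op m p (eigenbasis m n T) x
      = (if j \<in> jump_set n x \<longleftrightarrow> Suc j \<in> jump_set n x
         then \<nu> * C * eigenbasis m n T x + \<i> * S * eigenbasis m n T (flip_bit j x)
         else - \<i> * S * eigenbasis m n T x + C * eigenbasis m n T (flip_bit j x))"
    unfolding sigma_op_def sigma_diag_def sigma_flip_def bits
    by (simp add: \<nu>_def C_def S_def j_def)
  also have "\<dots> = (\<nu> * C - \<i> * S * (u j * u (Suc j))) * eigenbasis m n (s ` T) x"
  proof -
    have usq: "u j * u j = 1" "u (Suc j) * u (Suc j) = 1" by (simp_all add: u_def)
    have gg: "g * g' = - 1" "\<nu> * g = g'" "\<nu> * g' = g"
      using phases by (simp_all add: mult.left_commute[of g])
    note exchange = exchange_both[OF usq gg] exchange_left[OF usq gg] exchange_right[OF usq gg]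
      exchange_neither[OF usq gg]
    show ?thesis
      unfolding eig_x eig_flip eig_s
      using exchange[of C F "\<i> * S"]
      by (cases "j \<in> jump_set n x"; cases "Suc j \<in> jump_set n x") simp_all
  qed
  finally show ?thesis unfolding root[symmetric] by (simp add: j_def)
qed

section \<open>A faithful representation of the semidirect product\<close>

text \<open>The quadratic form \<open>\<Sum> a\<^bsub>jk\<^esub> y\<^sub>j y\<^sub>k\<close> at the sign vector that is \<open>- 1\<close> on \<open>T\<close>: the product \<open>y\<^sub>j y\<^sub>k\<close> is
  the Walsh character at the pair \<open>{j, k}\<close>.\<close>
definition pair_form :: "nat \<Rightarrow> (nat \<Rightarrow> int) \<Rightarrow> nat set \<Rightarrow> int" where
  "pair_form n a T = (\<Sum>k<num_pairs n. a k * walsh T (pair_enum n k))"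

text \<open>The form is evaluated at \<open>\<pi> ` T\<close>, the label after the permutation, since in \<open>(a, \<pi>)\<close> the
  translation \<open>a\<close> stands to the left of \<open>\<pi>\<close> and is applied last.\<close>
definition semidirect_matrix :: "nat \<Rightarrow> nat \<Rightarrow> (nat \<Rightarrow> int) \<times> (nat \<Rightarrow> nat) \<Rightarrow> complex mat" where
  "semidirect_matrix m n = (\<lambda>(a, \<pi>).
    orthonormal_columns.monomial_mat (2 ^ (n + 1)) (Pow {0..n}) (eigenbasis m n)
      (\<lambda>T. twist_sign m \<pi> * unit_root m (pair_form n a (\<pi> ` T))) ((`) \<pi>))"

lemma unit_root_add: "unit_root m (q + q') = unit_root m q * unit_root m q'"
  by (simp add: unit_root_def cis_mult add_divide_distrib ring_distribs)

lemma unit_root_eq_one_iff: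
  assumes "m > 0"
  shows "unit_root m q = 1 \<longleftrightarrow> int m dvd q"
proof
  assume "unit_root m q = 1"
  then have "cos (2 * pi * of_int q / real m) = 1" by (simp add: unit_root_def complex_eq_iff)
  then obtain k :: int where "2 * pi * of_int q / real m = of_int k * 2 * pi"
    by (auto simp: cos_one_2pi_int)
  then have "real_of_int q = of_int (int m * k)" using assms by (simp add: field_simps)
  then show "int m dvd q" by (simp only: of_int_eq_iff) simp
next
  assume "int m dvd q"
  then obtain k where "q = int m * k" by (elim dvdE)
  then have "2 * pi * of_int q / real m = 2 * pi * of_int k" using assms by simp
  then show "unit_root m q = 1" by (simp only: unit_root_def cis_multiple_2pi Ints_of_int)
qed

lemma unit_root_mod_cong:
  assumes "m > 0" "q mod int m = q' mod int m"
  shows "unit_root m q = unit_root m q'"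
proof -
  have "int m dvd q - q'" using assms(2) by (simp add: mod_eq_dvd_iff)
  then have "unit_root m (q' + (q - q')) = unit_root m q'"
    unfolding unit_root_add using unit_root_eq_one_iff[OF assms(1)] by simp
  then show ?thesis by simp
qed

lemma pair_form_action:
  assumes "\<pi> permutes {1..n}" "a \<in> carrier (pair_group m n)"
  shows "pair_form n (pair_action m n \<pi> a) (\<pi> ` T) = pair_form n a T"
proof -
  let ?q = "pair_perm n (inv' \<pi>)"
  have "pair_form n (pair_action m n \<pi> a) (\<pi> ` T)
      = (\<Sum>k<num_pairs n. a (?q k) * walsh T (pair_enum n (?q k)))"
    unfolding pair_form_def using assms
    by (intro sum.cong HOL.refl)
      (simp add: pair_action_apply walsh_image permutes_bij pair_enum_perm permutes_inv)
  also have "\<dots> = pair_form n a T"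
    unfolding pair_form_def
    by (rule sum.reindex_bij_betw[OF bij_betw_pair_perm[OF permutes_inv[OF assms(1)]]])
  finally show ?thesis .
qed

lemma unit_root_pair_form_mult:
  assumes "m > 0"
  shows "unit_root m (pair_form n (a \<otimes>\<^bsub>pair_group m n\<^esub> b) T)
    = unit_root m (pair_form n a T) * unit_root m (pair_form n b T)"
proof -
  have "int m dvd pair_form n (a \<otimes>\<^bsub>pair_group m n\<^esub> b) T - (pair_form n a T + pair_form n b T)"
  proof -
    have "pair_form n (a \<otimes>\<^bsub>pair_group m n\<^esub> b) T - (pair_form n a T + pair_form n b T)
        = (\<Sum>k<num_pairs n. ((a k + b k) mod int m - (a k + b k)) * walsh T (pair_enum n k))"
      by (simp add: pair_form_def cyclic_power_mult[OF assms] sum_subtractf ring_distribs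
          flip: sum.distrib)
    also have "int m dvd \<dots>"
      by (intro dvd_sum dvd_mult2) (simp add: mod_eq_dvd_iff[symmetric])
    finally show ?thesis .
  qed
  then show ?thesis
    using assms unit_root_mod_cong[of m "pair_form n (a \<otimes>\<^bsub>pair_group m n\<^esub> b) T"
        "pair_form n a T + pair_form n b T"]
    by (simp add: unit_root_add mod_eq_dvd_iff)
qed

text \<open>Fourier inversion: distinct pairs have orthogonal Walsh characters.\<close>
lemma pair_form_fourier:
  assumes "l < num_pairs n"
  shows "(\<Sum>T\<in>Pow {0..n}. walsh T (pair_enum n l) * pair_form n a T) = 2 ^ (n + 1) * a l"
proof -
  have sub: "pair_enum n k \<subseteq> {0..n}" if "k < num_pairs n" for k
    using pair_enum_subset[OF that] by (rule subset_trans) auto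
  have "(\<Sum>T\<in>Pow {0..n}. walsh T (pair_enum n l) * pair_form n a T)
      = (\<Sum>T\<in>Pow {0..n}. \<Sum>k<num_pairs n. a k * (walsh (pair_enum n l) T * walsh (pair_enum n k) T))"
    by (simp add: pair_form_def sum_distrib_left walsh_commute[of "pair_enum n _"] mult_ac)
  also have "\<dots> = (\<Sum>k<num_pairs n. a k *
      (\<Sum>T\<in>Pow {0..n}. walsh (pair_enum n l) T * walsh (pair_enum n k) T))"
    by (subst sum.swap) (simp add: sum_distrib_left)
  also have "\<dots> = (\<Sum>k<num_pairs n. if k = l then 2 ^ (n + 1) * a l else 0)"
    using assms
    by (intro sum.cong HOL.refl) (auto simp: walsh_orthogonal sub pair_enum_eq_iff)
  finally show ?thesis using assms by (simp add: sum.delta)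
qed

lemma twist_sign_id: "twist_sign m id = 1"
  by (simp add: twist_sign_def)

lemma twist_sign_comp:
  assumes "\<pi> permutes {1..n}" "\<tau> permutes {1..n}"
  shows "twist_sign m (\<pi> \<circ> \<tau>) = twist_sign m \<pi> * twist_sign m \<tau>"
  using assms by (simp add: twist_sign_def sign_compose permutes_imp_permutation[OF finite_atLeastAtMost])

lemma permutes_image_Pow:
  fixes n :: nat
  assumes "\<pi> permutes {1..n}" "T \<in> Pow {0..n}"
  shows "\<pi> ` T \<in> Pow {0..n}"
proof -
  have "\<pi> permutes {0..n}" using assms(1) by (rule permutes_subset) auto
  then show ?thesis using assms(2) permutes_image by blast
qed

lemma semidirect_matrix_carrier: "semidirect_matrix m n x \<in> carrier_mat (2 ^ (n + 1)) (2 ^ (n + 1))"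
  unfolding semidirect_matrix_def
  by (cases x) (simp add: orthonormal_columns.monomial_mat_carrier[OF eigenbasis_orthonormal_columns, simplified])

lemma semidirect_matrix_mult:
  assumes m: "m > 0" and x: "x \<in> carrier (pair_semidirect m n)" and y: "y \<in> carrier (pair_semidirect m n)"
  shows "semidirect_matrix m n (x \<otimes>\<^bsub>pair_semidirect m n\<^esub> y) = semidirect_matrix m n x * semidirect_matrix m n y"
proof -
  interpret orthonormal_columns "2 ^ (n + 1)" "Pow {0..n}" "eigenbasis m n"
    by (rule eigenbasis_orthonormal_columns)
  obtain a \<pi> b \<tau> where xy: "x = (a, \<pi>)" "y = (b, \<tau>)" by (cases x, cases y)
  have a: "a \<in> carrier (pair_group m n)" "\<pi> permutes {1..n}"
    and b: "b \<in> carrier (pair_group m n)" "\<tau> permutes {1..n}"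
    using x y by (simp_all add: xy pair_semidirect_carrier)
  have "(`) \<tau> \<in> Pow {0..n} \<rightarrow> Pow {0..n}" using permutes_image_Pow[OF b(2)] by blast
  note mult = monomial_mat_mult[OF this]
  have action: "pair_form n (pair_action m n \<pi> b) ((\<lambda>j. \<pi> (\<tau> j)) ` T) = pair_form n b (\<tau> ` T)" for T
    using pair_form_action[OF a(2) b(1), of "\<tau> ` T"] by (simp add: image_image)
  show ?thesis
    unfolding semidirect_matrix_def xy pair_semidirect_mult prod.case mult
    by (rule monomial_mat_cong)
      (simp_all add: twist_sign_comp[OF a(2) b(2)] unit_root_pair_form_mult[OF m]
        action image_image mult_ac)
qed

lemma semidirect_matrix_one:
  assumes "m > 0"
  shows "semidirect_matrix m n \<one>\<^bsub>pair_semidirect m n\<^esub> = 1\<^sub>m (2 ^ (n + 1))"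
proof -
  interpret orthonormal_columns "2 ^ (n + 1)" "Pow {0..n}" "eigenbasis m n"
    by (rule eigenbasis_orthonormal_columns)
  show ?thesis
    unfolding semidirect_matrix_def pair_semidirect_one prod.case monomial_mat_one[symmetric]
    by (rule monomial_mat_cong)
      (simp_all add: twist_sign_id unit_root_def pair_form_def cyclic_power_one[OF assms])
qed

lemma semidirect_matrix_hom:
  assumes "m > 0"
  shows "semidirect_matrix m n \<in> hom (pair_semidirect m n) (GL_mat (2 ^ (n + 1)))"
proof (rule homI)
  interpret K: group "pair_semidirect m n" by (rule group_pair_semidirect[OF assms])
  fix x assume x: "x \<in> carrier (pair_semidirect m n)"
  let ?A = "semidirect_matrix m n x" and ?B = "semidirect_matrix m n (inv\<^bsub>pair_semidirect m n\<^esub> x)"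
  have "?A * ?B = 1\<^sub>m (2 ^ (n + 1))" "?B * ?A = 1\<^sub>m (2 ^ (n + 1))"
    using x semidirect_matrix_mult[OF assms, of _ n, symmetric] semidirect_matrix_one[OF assms, of n] by simp_all
  then have "?A \<in> Units (ring_mat TYPE(complex) (2 ^ (n + 1)) ())"
    using semidirect_matrix_carrier[of m n x]
      semidirect_matrix_carrier[of m n "inv\<^bsub>pair_semidirect m n\<^esub> x"]
    unfolding Units_def ring_mat_simps by blast
  then show "?A \<in> carrier (GL_mat (2 ^ (n + 1)))" by (simp add: GL_mat_def units_of_carrier)
qed (simp add: semidirect_matrix_mult[OF assms])

text \<open>The identity permutes no labels, and singletons as labels show that \<open>\<pi>\<close> is trivial. Then all values of the
  form are divisible by \<open>m\<close>, hence so is \<open>2 ^ (n + 1)\<close> times each coefficient, and \<open>m\<close> is odd.\<close>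
lemma semidirect_matrix_eq_oneD:
  assumes m: "odd m" and x: "x \<in> carrier (pair_semidirect m n)"
    and eq: "semidirect_matrix m n x = 1\<^sub>m (2 ^ (n + 1))"
  shows "x = \<one>\<^bsub>pair_semidirect m n\<^esub>"
proof -
  interpret orthonormal_columns "2 ^ (n + 1)" "Pow {0..n}" "eigenbasis m n"
    by (rule eigenbasis_orthonormal_columns)
  have m_pos: "m > 0" using m by (rule odd_pos)
  obtain a \<pi> where x_eq: "x = (a, \<pi>)" by (cases x)
  have a: "a \<in> carrier (pair_group m n)" and \<pi>: "\<pi> permutes {1..n}"
    using x by (simp_all add: x_eq pair_semidirect_carrier)
  have fixes_T: "\<pi> ` T = T" and root: "twist_sign m \<pi> * unit_root m (pair_form n a (\<pi> ` T)) = 1"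
    if "T \<in> Pow {0..n}" for T
    using monomial_mat_eq_oneD[OF eq[unfolded semidirect_matrix_def x_eq prod.case] that]
      permutes_image_Pow[OF \<pi> that] by blast+
  have "\<pi> j = j" for j
    using fixes_T[of "{j}"] permutes_not_in[OF \<pi>, of j] by (cases "j \<in> {1..n}") auto
  then have id: "\<pi> = id" by (simp add: fun_eq_iff)
  have dvd: "int m dvd pair_form n a T" if "T \<in> Pow {0..n}" for T
    using root[OF that] by (simp add: id twist_sign_id unit_root_eq_one_iff[OF m_pos])
  have "a l = 0" if l: "l < num_pairs n" for l
  proof -
    have "int m dvd 2 ^ (n + 1) * a l"
      unfolding pair_form_fourier[OF l, symmetric] by (intro dvd_sum dvd_mult dvd)
    moreover have "coprime (int m) (2 ^ (n + 1))" using m by simp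
    ultimately have "int m dvd a l" by (simp only: coprime_dvd_mult_right_iff)
    moreover have "0 \<le> a l" "a l < int m"
      using a l by (auto simp: cyclic_power_carrier[OF m_pos] PiE_iff)
    ultimately show "a l = 0" by (metis dvd_imp_mod_0 mod_pos_pos_trivial)
  qed
  then have "a = \<one>\<^bsub>pair_group m n\<^esub>"
    using a by (intro extensionalityI[of _ "{..<num_pairs n}"])
      (auto simp: cyclic_power_one[OF m_pos] cyclic_power_carrier[OF m_pos] PiE_iff)
  then show ?thesis by (simp add: x_eq id pair_semidirect_one)
qed

section \<open>The image of the braid group\<close>

text \<open>Qubits are numbered from the left but bits from the lowest one, so generator \<open>i\<close> acts on the jumps
  \<open>n - i\<close> and \<open>n - i + 1\<close>.\<close>
lemma sigma_mat_eq_semidirect_matrix: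
  assumes m: "odd m" "m \<ge> 3" and i: "i \<in> {1..<n}"
  shows "sigma_mat m n i = semidirect_matrix m n (braid_element m n (braid_exponent m) (n - i))"
proof -
  interpret orthonormal_columns "2 ^ (n + 1)" "Pow {0..n}" "eigenbasis m n"
    by (rule eigenbasis_orthonormal_columns)
  define p where "p = n - i - 1"
  let ?j = "Suc p" and ?c = "braid_exponent m"
  let ?s = "transpose ?j (Suc ?j)" and ?k = "pair_index n {?j, Suc ?j}"
  have p: "n - i = ?j" "p + 2 \<le> n" using i by (auto simp: p_def)
  have m_pos: "m > 0" using m(2) by simp
  have pair: "{?j, Suc ?j} \<in> vertex_pairs n" using p by (intro adjacent_vertex_pair) auto
  have k: "?k < num_pairs n" by (rule pair_index_less[OF pair])
  have form: "unit_root m (pair_form n (single_pair m n ?k ?c) (?s ` T))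
      = unit_root m (?c * walsh T {?j, Suc ?j})" for T
  proof -
    have "pair_form n (single_pair m n ?k ?c) (?s ` T)
        = (\<Sum>l<num_pairs n. if l = ?k then (?c mod int m) * walsh (?s ` T) (pair_enum n l) else 0)"
      unfolding pair_form_def by (rule sum.cong) (simp_all add: single_pair_def)
    also have "\<dots> = (?c mod int m) * walsh (?s ` T) {?j, Suc ?j}"
      using k by (simp add: sum.delta pair_enum_index[OF pair])
    also have "walsh (?s ` T) {?j, Suc ?j} = (walsh T {?j, Suc ?j} :: int)"
      by (simp add: walsh_insert image_iff transpose_def)
    finally show ?thesis
      by (intro unit_root_mod_cong[OF m_pos]) (simp add: mod_mult_left_eq)
  qed
  have "sigma_mat m n i = monomial_mat
      (\<lambda>T. twist_sign m ?s * unit_root m (pair_form n (single_pair m n ?k ?c) (?s ` T))) ((`) ?s)"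
  proof (rule mat_eq_monomial_mat)
    show "sigma_mat m n i \<in> carrier_mat (2 ^ (n + 1)) (2 ^ (n + 1))" using i by (rule sigma_mat_carrier)
    fix T x assume x: "x < (2::nat) ^ (n + 1)"
    \<comment> \<open>a basis vector as a one-column matrix, so that the entry formula for products applies\<close>
    let ?A = "mat (2 ^ (n + 1)) 1 (\<lambda>(y, _). eigenbasis m n T y)"
    have "(\<Sum>y<2 ^ (n + 1). sigma_mat m n i $$ (x, y) * eigenbasis m n T y)
        = (sigma_mat m n i * ?A) $$ (x, 0)"
      using x sigma_mat_carrier[OF i, of m] by (simp add: scalar_prod_def atLeast0LessThan)
    also have "\<dots> = sigma_op m p (\<lambda>y. ?A $$ (y, 0)) x"
      unfolding p_def by (rule sigma_mat_mult_entry[OF i _ x, where k = 1]) simp_all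
    also have "\<dots> = sigma_op m p (eigenbasis m n T) x"
      unfolding p_def by (rule sigma_op_cong[OF i x]) simp
    also have "\<dots> = twist_sign m ?s * unit_root m (pair_form n (single_pair m n ?k ?c) (?s ` T))
        * eigenbasis m n (?s ` T) x"
      unfolding form by (rule sigma_op_eigenbasis[OF m p(2)])
    finally show "(\<Sum>y<2 ^ (n + 1). sigma_mat m n i $$ (x, y) * eigenbasis m n T y)
        = twist_sign m ?s * unit_root m (pair_form n (single_pair m n ?k ?c) (?s ` T))
          * eigenbasis m n (?s ` T) x" .
  qed
  then show ?thesis by (simp add: semidirect_matrix_def braid_element_def p(1))
qed

lemma rho_image:
  "rho m n ` carrier (braid_group n) = generate (GL_mat (2 ^ (n + 1))) (sigma_mat m n ` {1..<n})"
proof -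
  interpret group "GL_mat (2 ^ (n + 1))" by (rule group_GL_mat)
  have f: "sigma_mat m n \<in> {1..<n} \<rightarrow> carrier (GL_mat (2 ^ (n + 1)))" using sigma_mat_GL by auto
  have "rho m n ` carrier (braid_group n)
      = gword_eval (GL_mat (2 ^ (n + 1))) (sigma_mat m n) ` gwords {1..<n}"
    unfolding braid_group_def presented_group_def partial_object.simps image_image rho_def
    by (intro image_cong HOL.refl pres_hom_pres_class[OF f] gword_eval_braid_relations)
  then show ?thesis by (simp only: gword_evals_eq_generate[OF f])
qed

text \<open>Both sides are generated by the images of the braid generators: the left by definition, the right
  because the corresponding elements generate the semidirect product.\<close>
lemma rho_image_eq_semidirect:
  assumes m: "odd m" "m \<ge> 3" and n: "n \<ge> 2"
  shows "rho m n ` carrier (braid_group n) = semidirect_matrix m n ` carrier (pair_semidirect m n)"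
proof -
  let ?K = "pair_semidirect m n" and ?b = "braid_element m n (braid_exponent m)"
  have m_pos: "m > 0" using m(2) by simp
  interpret h: group_hom ?K "GL_mat (2 ^ (n + 1))" "semidirect_matrix m n"
    by (intro group_hom.intro group_hom_axioms.intro group_pair_semidirect group_GL_mat
        semidirect_matrix_hom m_pos)
  obtain d where d: "braid_exponent m * d mod int m = 1 mod int m"
    using braid_exponent_inverse[OF m(1)] by blast
  have "(-) n ` {1..<n} = {1..<n}"
  proof (intro equalityI subsetI)
    fix j assume "j \<in> {1..<n}"
    then show "j \<in> (-) n ` {1..<n}" by (intro image_eqI[of _ _ "n - j"]) auto
  qed auto
  then have "sigma_mat m n ` {1..<n} = semidirect_matrix m n ` ?b ` {1..<n}"
    using sigma_mat_eq_semidirect_matrix[OF m, of _ n]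
    by (metis (no_types, lifting) image_cong image_image)
  then have "rho m n ` carrier (braid_group n)
      = generate (GL_mat (2 ^ (n + 1))) (semidirect_matrix m n ` ?b ` {1..<n})"
    by (simp only: rho_image)
  also have "\<dots> = semidirect_matrix m n ` generate ?K (?b ` {1..<n})"
    using braid_element_carrier[OF m_pos, of _ n] by (intro h.generate_img) auto
  also have "\<dots> = semidirect_matrix m n ` carrier ?K"
    by (simp only: braid_elements_generate[OF m_pos m(1) n d])
  finally show ?thesis .
qed

theorem theorem4:
  fixes m n :: nat
  assumes "odd m" and "m \<ge> 3" and "n \<ge> 2"
  shows "\<exists>\<phi> \<in> hom (sym_group n) (AutoGroup (cyclic_power m (n * (n - 1) div 2))).
    (GL_mat (2 ^ (n + 1)))\<lparr>carrier := rho m n ` carrier (braid_group n)\<rparr>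
      \<cong> semidirect_product (cyclic_power m (n * (n - 1) div 2)) (sym_group n) \<phi>"
proof -
  let ?K = "pair_semidirect m n" and ?f = "semidirect_matrix m n"
  let ?H = "(GL_mat (2 ^ (n + 1)))\<lparr>carrier := rho m n ` carrier (braid_group n)\<rparr>"
  have m_pos: "m > 0" using assms(2) by simp
  interpret h: group_hom ?K "GL_mat (2 ^ (n + 1))" ?f
    by (intro group_hom.intro group_hom_axioms.intro group_pair_semidirect group_GL_mat
        semidirect_matrix_hom m_pos)
  have image: "rho m n ` carrier (braid_group n) = ?f ` carrier ?K"
    using assms by (rule rho_image_eq_semidirect)
  have "inj_on ?f (carrier ?K)"
    unfolding h.inj_on_one_iff using semidirect_matrix_eq_oneD[OF assms(1)] by simp
  then have "?f \<in> iso ?K ?H"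
    using h.hom_mult by (auto simp: iso_def hom_def bij_betw_def image)
  then have "?H \<cong> ?K"
    by (intro group.iso_sym[OF group_pair_semidirect[OF m_pos]]) (auto simp: is_iso_def)
  then show ?thesis
    using pair_action_hom[OF m_pos, of n] unfolding num_pairs_def by blast
qed

end
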